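(* Let $k>1$, let $\gamma : [0,1]\to SO_{2k}$ be a path from $\mathbb{1}$ to $-\mathbb{1}$, let $\eta : [0,1] \to SO_{2k}$ be a loop based at $\mathbb{1}$ representing the generator of $\pi_1(SO_{2k}) \cong \mathbb{Z}/2$, let $X$ be a CW-complex, and let $E \to SX$ be an oriented rank-$2k$ vector bundle with clutching function $g : X \to SO_{2k}$. Then: (a) $2\,\mathrm{TO}_\eta([g]) = 0$; (b) $\mathrm{TO}_{\eta * \gamma}([g]) = \mathrm{TO}_\eta([g]) + \mathrm{TO}_\gamma([g])$; (c) if $k$ is even, then $2\,\mathrm{TO}_\gamma([g]) = 0$; (d) if $k$ is odd, then $2\,\mathrm{TO}_\gamma([g]) = \mathrm{TO}_\eta([g])$ and $4\,\mathrm{TO}_\gamma([g]) = 0$.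
   Context: $SX$ is the (unreduced) suspension of $X$, with points $[x,t]$, $(x,t)\in X\times[0,1]$. For any path $\delta : [0,1] \to SO_{2k}$ with endpoints in $\{\pm\mathbb{1}\}$, define $$\mathrm{TO}_\delta : [X,SO_{2k}] \to [SX,SO_{2k}], \quad [g] \mapsto \big[\,[x,t] \mapsto g(x)\delta(t)g(x)^{-1}\,\big].$$ Here $[X,SO_{2k}]$ and $[SX,SO_{2k}]$ denote (free) homotopy classes of maps; $[SX,SO_{2k}]$ is an abelian group (under pointwise multiplication), written additively, with $0$ the class of constant maps. $\eta*\gamma$ denotes concatenation of paths. Oriented rank-$2k$ bundles over $SX$ are classified by the homotopy class $[g]\in[X,SO_{2k}]$ of their clutching function. *)

theory Defs
  imports "HOL-Analysis.Analysis" "HOL-Algebra.Generated_Groups"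
begin

section \<open>CW complexes\<close>

definition closed_disc :: "nat \<Rightarrow> (nat \<Rightarrow> real) set" where
  "closed_disc n = {x \<in> topspace (Euclidean_space n). (\<Sum>i<n. (x i)\<^sup>2) \<le> 1}"

definition open_disc :: "nat \<Rightarrow> (nat \<Rightarrow> real) set" where
  "open_disc n = {x \<in> topspace (Euclidean_space n). (\<Sum>i<n. (x i)\<^sup>2) < 1}"

text \<open>
  Whitehead's definition of a CW structure on a Hausdorff space. The set \<open>C\<close> consists of the
  open cells, \<open>d e\<close> is the dimension of the cell \<open>e\<close> and \<open>\<Phi> e\<close> is its characteristic map.
\<close>

definition CW_structure ::
  "'a topology \<Rightarrow> 'a set set \<Rightarrow> ('a set \<Rightarrow> nat) \<Rightarrow> ('a set \<Rightarrow> (nat \<Rightarrow> real) \<Rightarrow> 'a) \<Rightarrow> bool" where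
  "CW_structure X C d \<Phi> \<longleftrightarrow>
     \<Union>C = topspace X \<and> disjoint C \<and>
     (\<forall>e\<in>C.
        continuous_map (subtopology (Euclidean_space (d e)) (closed_disc (d e))) X (\<Phi> e) \<and>
        homeomorphic_map (subtopology (Euclidean_space (d e)) (open_disc (d e)))
          (subtopology X e) (\<Phi> e) \<and>
        (\<exists>F\<subseteq>C. finite F \<and> (\<forall>f\<in>F. d f < d e) \<and>
          \<Phi> e ` (closed_disc (d e) - open_disc (d e)) \<subseteq> \<Union>F)) \<and>
     (\<forall>S\<subseteq>topspace X. (\<forall>e\<in>C. closedin X (S \<inter> X closure_of e)) \<longrightarrow> closedin X S)"

definition CW_complex :: "'a topology \<Rightarrow> bool" where
  "CW_complex X \<longleftrightarrow> Hausdorff_space X \<and> (\<exists>C d \<Phi>. CW_structure X C d \<Phi>)"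


section \<open>The unreduced suspension\<close>

definition quotient_topology :: "'a topology \<Rightarrow> ('a \<Rightarrow> 'b) \<Rightarrow> 'b topology" where
  "quotient_topology X q =
     topology (\<lambda>U. U \<subseteq> q ` topspace X \<and> openin X {x \<in> topspace X. q x \<in> U})"

lemma openin_quotient_topology:
  "openin (quotient_topology X q) U \<longleftrightarrow>
     U \<subseteq> q ` topspace X \<and> openin X {x \<in> topspace X. q x \<in> U}"
proof -
  have "istopology (\<lambda>U. U \<subseteq> q ` topspace X \<and> openin X {x \<in> topspace X. q x \<in> U})"
    unfolding istopology_def
  proof (intro conjI allI impI)
    fix S T
    assume S: "S \<subseteq> q ` topspace X \<and> openin X {x \<in> topspace X. q x \<in> S}"
      and T: "T \<subseteq> q ` topspace X \<and> openin X {x \<in> topspace X. q x \<in> T}"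
    then show "S \<inter> T \<subseteq> q ` topspace X" by blast
    have "{x \<in> topspace X. q x \<in> S \<inter> T} =
        {x \<in> topspace X. q x \<in> S} \<inter> {x \<in> topspace X. q x \<in> T}" by blast
    then show "openin X {x \<in> topspace X. q x \<in> S \<inter> T}" using S T by auto
  next
    fix K
    assume K: "\<forall>S\<in>K. S \<subseteq> q ` topspace X \<and> openin X {x \<in> topspace X. q x \<in> S}"
    then show "\<Union>K \<subseteq> q ` topspace X" by blast
    have "{x \<in> topspace X. q x \<in> \<Union>K} = (\<Union>S\<in>K. {x \<in> topspace X. q x \<in> S})" by blast
    then show "openin X {x \<in> topspace X. q x \<in> \<Union>K}" using K by auto
  qed
  then show ?thesis
    by (simp add: quotient_topology_def)
qed

lemma topspace_quotient_topology: "topspace (quotient_topology X q) = q ` topspace X"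
proof -
  have "{x \<in> topspace X. q x \<in> q ` topspace X} = topspace X" by blast
  then have "openin (quotient_topology X q) (q ` topspace X)"
    by (simp add: openin_quotient_topology)
  then show ?thesis
    by (metis openin_quotient_topology openin_subset openin_topspace subset_antisym)
qed

lemma quotient_map_quotient_topology: "quotient_map X (quotient_topology X q) q"
  by (simp add: quotient_map_def topspace_quotient_topology openin_quotient_topology)

text \<open>
  The point \<open>[x,t]\<close> is the equivalence class of \<open>(x,t)\<close> for the relation collapsing
  \<open>X \<times> {0}\<close> and \<open>X \<times> {1}\<close> to one point each.
\<close>

definition susp_point :: "'a topology \<Rightarrow> 'a \<Rightarrow> real \<Rightarrow> ('a \<times> real) set" where
  "susp_point X x t =
     {(y, s). y \<in> topspace X \<and> s \<in> {0..1} \<and> s = t \<and> (y = x \<or> t = 0 \<or> t = 1)}"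

definition suspension :: "'a topology \<Rightarrow> ('a \<times> real) set topology" where
  "suspension X =
     quotient_topology (prod_topology X (top_of_set {0..1})) (\<lambda>(x, t). susp_point X x t)"


section \<open>Homotopy classes of maps and the special orthogonal group\<close>

definition SO_set :: "(real^'n^'n) set" where
  "SO_set = {A. rotation_matrix A}"

abbreviation SO :: "(real^'n^'n) topology" where
  "SO \<equiv> top_of_set SO_set"

definition homotopy_class :: "'a topology \<Rightarrow> 'b topology \<Rightarrow> ('a \<Rightarrow> 'b) \<Rightarrow> ('a \<Rightarrow> 'b) set" where
  "homotopy_class X Y f = {h. homotopic_with (\<lambda>_. True) X Y f h}"

text \<open>
  Operations on classes are defined on representatives throughout, \<open>the_elem\<close> selecting the
  common value. The group \<open>[Y, SO]\<close> is written additively in the literature when \<open>Y\<close> is a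
  suspension; here it is a multiplicatively written monoid, so that \<open>a + b\<close> is \<open>a \<otimes> b\<close>, the
  multiple \<open>m a\<close> is \<open>a [^] m\<close>, and \<open>0\<close> is \<open>\<one>\<close>. (As \<open>SO\<close> is path connected, all constant maps lie
  in the class \<open>\<one>\<close>.)
\<close>

definition SO_classes :: "'y topology \<Rightarrow> ('y \<Rightarrow> real^'n^'n) set monoid" where
  "SO_classes Y =
     \<lparr>carrier = homotopy_class Y SO ` {f. continuous_map Y SO f},
      mult = (\<lambda>a b. the_elem ((\<lambda>(f, h). homotopy_class Y SO (\<lambda>y. f y ** h y)) ` (a \<times> b))),
      one = homotopy_class Y SO (\<lambda>_. mat 1)\<rparr>"


section \<open>The fundamental group\<close>

definition loops :: "'a::topological_space set \<Rightarrow> 'a \<Rightarrow> (real \<Rightarrow> 'a) set" where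
  "loops S a = {p. path p \<and> path_image p \<subseteq> S \<and> pathstart p = a \<and> pathfinish p = a}"

definition path_class :: "'a::topological_space set \<Rightarrow> (real \<Rightarrow> 'a) \<Rightarrow> (real \<Rightarrow> 'a) set" where
  "path_class S p = {q. homotopic_paths S p q}"

definition fundamental_group :: "'a::topological_space set \<Rightarrow> 'a \<Rightarrow> (real \<Rightarrow> 'a) set monoid" where
  "fundamental_group S a =
     \<lparr>carrier = path_class S ` loops S a,
      mult = (\<lambda>c d. the_elem ((\<lambda>(p, q). path_class S (p +++ q)) ` (c \<times> d))),
      one = path_class S (\<lambda>_. a)\<rparr>"


section \<open>Oriented vector bundles and clutching functions\<close>

definition trivialization ::
  "'b topology \<Rightarrow> 'e topology \<Rightarrow> ('e \<Rightarrow> 'b) \<Rightarrow> 'b set \<Rightarrow> ('b \<times> (real^'n) \<Rightarrow> 'e) \<Rightarrow> bool" where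
  "trivialization B E p U \<phi> \<longleftrightarrow>
     homeomorphic_map (prod_topology (subtopology B U) euclidean)
       (subtopology E {e \<in> topspace E. p e \<in> U}) \<phi> \<and>
     (\<forall>b\<in>U. \<forall>v. p (\<phi> (b, v)) = b)"

definition oriented_compatible ::
  "'b set \<Rightarrow> ('b \<times> (real^'n) \<Rightarrow> 'e) \<Rightarrow> 'b set \<Rightarrow> ('b \<times> (real^'n) \<Rightarrow> 'e) \<Rightarrow> bool" where
  "oriented_compatible U \<phi> V \<psi> \<longleftrightarrow>
     (\<forall>b\<in>U \<inter> V. \<exists>M::real^'n^'n. det M > 0 \<and> (\<forall>v. \<phi> (b, v) = \<psi> (b, M *v v)))"

text \<open>
  An oriented vector bundle of rank \<open>CARD('n)\<close> with projection \<open>p\<close>, given by an atlas \<open>A\<close> of local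
  trivializations whose transition functions are fibrewise linear and orientation preserving.
  The atlas induces the vector space structure and the orientation of the fibres; continuity of
  the transition functions is automatic, the trivializations being homeomorphisms.
\<close>

definition oriented_vector_bundle ::
  "'b topology \<Rightarrow> 'e topology \<Rightarrow> ('e \<Rightarrow> 'b) \<Rightarrow> ('b set \<times> ('b \<times> (real^'n) \<Rightarrow> 'e)) set \<Rightarrow> bool" where
  "oriented_vector_bundle B E p A \<longleftrightarrow>
     continuous_map E B p \<and>
     (\<Union>(U, \<phi>)\<in>A. U) = topspace B \<and>
     (\<forall>(U, \<phi>)\<in>A. openin B U \<and> trivialization B E p U \<phi>) \<and>
     (\<forall>(U, \<phi>)\<in>A. \<forall>(V, \<psi>)\<in>A. oriented_compatible U \<phi> V \<psi>)"

definition half_cone :: "'a topology \<Rightarrow> real set \<Rightarrow> ('a \<times> real) set set" where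
  "half_cone X I = {susp_point X x t | x t. x \<in> topspace X \<and> t \<in> I}"

text \<open>
  \<open>E\<close> is trivial over the two cones \<open>t \<le> 1/2\<close> and \<open>t \<ge> 1/2\<close> of the suspension; a clutching
  function compares oriented trivializations over their common boundary.
\<close>

definition has_clutching_function ::
  "'a topology \<Rightarrow> 'e topology \<Rightarrow> ('e \<Rightarrow> ('a \<times> real) set) \<Rightarrow>
     (('a \<times> real) set set \<times> (('a \<times> real) set \<times> (real^'n) \<Rightarrow> 'e)) set \<Rightarrow>
     ('a \<Rightarrow> real^'n^'n) \<Rightarrow> bool" where
  "has_clutching_function X E p A g \<longleftrightarrow>
     continuous_map X SO g \<and>
     (\<exists>\<phi> \<psi>.
        trivialization (suspension X) E p (half_cone X {0..1/2}) \<phi> \<and>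
        trivialization (suspension X) E p (half_cone X {1/2..1}) \<psi> \<and>
        (\<forall>(U, \<theta>)\<in>A. oriented_compatible (half_cone X {0..1/2}) \<phi> U \<theta> \<and>
                     oriented_compatible (half_cone X {1/2..1}) \<psi> U \<theta>) \<and>
        (\<forall>x\<in>topspace X. \<forall>v.
           \<phi> (susp_point X x (1/2), v) = \<psi> (susp_point X x (1/2), g x *v v)))"


section \<open>The operation \<open>TO\<close>\<close>

text \<open>
  Off the two cone points a class \<open>z\<close> is a singleton; at the cone points the value is unambiguous
  because \<open>\<delta> 0\<close> and \<open>\<delta> 1\<close> are \<open>\<plusminus>\<one>\<close>, hence central.
\<close>

definition TO_map ::
  "(real \<Rightarrow> real^'n^'n) \<Rightarrow> ('a \<Rightarrow> real^'n^'n) \<Rightarrow> ('a \<times> real) set \<Rightarrow> real^'n^'n" where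
  "TO_map \<delta> g z = the_elem ((\<lambda>(x, t). g x ** \<delta> t ** matrix_inv (g x)) ` z)"

definition TO ::
  "'a topology \<Rightarrow> (real \<Rightarrow> real^'n^'n) \<Rightarrow> ('a \<Rightarrow> real^'n^'n) set \<Rightarrow>
     (('a \<times> real) set \<Rightarrow> real^'n^'n) set" where
  "TO X \<delta> c = the_elem ((\<lambda>g. homotopy_class (suspension X) SO (TO_map \<delta> g)) ` c)"

end

theory Submission
  imports Defs
begin

text \<open>
  Two properties turn the theorem into a computation with paths of rotations. First, conjugation
  by \<open>g x\<close> is multiplicative, so the pointwise product of \<open>\<delta>\<close> and \<open>\<epsilon>\<close> induces the product of the
  two maps on the suspension (\<open>TO_mult\<close>). Second, a homotopy of paths with fixed endpoints induces a
  homotopy of these maps (\<open>TO_cong\<close>). Part (b) follows because the concatenation \<open>\<eta> +++ \<gamma>\<close> is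
  homotopic to the pointwise product. The other parts ask which loops are
  \<open>t \<mapsto> \<eta>(t)\<^sup>2\<close> and \<open>t \<mapsto> \<gamma>(t)\<^sup>2\<close>.

  Let \<open>\<rho>\<close> be one full turn in a coordinate plane. Conjugating along a path that starts at the
  identity does not change the class of a loop. A half turn in a plane that shares one axis with the
  given plane conjugates \<open>\<rho>\<close> to its inverse, whence \<open>\<rho>\<^sup>2\<close> is null-homotopic
  (\<open>turns_even\<close>), and a quarter turn moves \<open>\<rho>\<close> from one plane to another
  (\<open>turns_any_plane\<close>).

  Every loop is homotopic to the identity or to \<open>\<rho>\<close> (\<open>loop_SO_cases\<close>). For a loop \<open>A\<close> and a basis
  vector \<open>e\<close> the orbit \<open>A(t) e\<close> is a loop on a sphere of dimension at least two, hence null-homotopic.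
  The null-homotopy is followed in small steps by the rotation which takes one unit vector to
  another one near it, and this deforms \<open>A\<close> into a loop which fixes \<open>e\<close> (\<open>lift_homotopy\<close>). After all basis
  vectors except two have been treated in this way, the loop lives in a single plane and an angle
  function identifies it with a number of full turns. In particular squares of loops
  are null-homotopic, which is (a), and a generator \<open>\<eta>\<close> must be homotopic to \<open>\<rho>\<close>: otherwise
  \<open>\<eta>\<close> is null-homotopic, the group it generates is trivial, and then \<open>\<rho>\<close> is null-homotopic as well.

  Finally, the simultaneous rotation of \<open>k\<close> complementary planes through the angle \<open>\<pi> t\<close> is a path
  \<open>P\<close> from the identity to its negative, with square the product of \<open>k\<close> full turns. Writing \<open>\<gamma> = P \<beta>\<close>
  with a loop \<open>\<beta>\<close> shows that \<open>\<gamma>\<^sup>2\<close> is homotopic to \<open>P\<^sup>2 \<beta>\<^sup>2\<close>, hence to \<open>\<rho>\<^sup>k\<close>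
  (\<open>square_path_to_minus_one\<close>). This is trivial for even \<open>k\<close> and \<open>\<eta>\<close> for odd \<open>k\<close>, which
  gives (c) and (d).
\<close>

section \<open>Matrix algebra and the special orthogonal group\<close>

lemma continuous_on_matrix_mult [continuous_intros]:
  fixes f :: "'a::topological_space \<Rightarrow> real^'n^'m" and g :: "'a \<Rightarrow> real^'l^'n"
  assumes "continuous_on S f" "continuous_on S g"
  shows "continuous_on S (\<lambda>x. f x ** g x)"
  unfolding matrix_matrix_mult_def using assms by (intro continuous_intros)

lemma continuous_on_transpose [continuous_intros]:
  fixes f :: "'a::topological_space \<Rightarrow> real^'n^'m"
  assumes "continuous_on S f"
  shows "continuous_on S (\<lambda>x. transpose (f x))"
  unfolding transpose_def using assms by (intro continuous_intros)

lemma continuous_on_matrix_vector_mult [continuous_intros]: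
  fixes f :: "'a::topological_space \<Rightarrow> real^'n^'m"
  assumes "continuous_on S f" "continuous_on S g"
  shows "continuous_on S (\<lambda>x. f x *v g x)"
  unfolding matrix_vector_mult_def using assms by (intro continuous_intros)

lemma continuous_on_det [continuous_intros]:
  fixes f :: "'a::topological_space \<Rightarrow> real^'n^'n"
  assumes "continuous_on S f"
  shows "continuous_on S (\<lambda>x. det (f x))"
  unfolding det_def using assms by (intro continuous_intros)

lemma SO_set_iff: "A \<in> SO_set \<longleftrightarrow> orthogonal_matrix A \<and> det A = 1"
  by (simp add: SO_set_def rotation_matrix_def)

lemma SO_one [simp]: "mat 1 \<in> SO_set"
  by (simp add: SO_set_iff orthogonal_matrix_id)

lemma SO_mult: "A \<in> SO_set \<Longrightarrow> B \<in> SO_set \<Longrightarrow> A ** B \<in> SO_set"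
  by (simp add: SO_set_iff orthogonal_matrix_mul det_mul)

lemma SO_transpose: "A \<in> SO_set \<Longrightarrow> transpose A \<in> SO_set"
  by (simp add: SO_set_iff det_transpose)

lemma SO_inverse [simp]:
  assumes "A \<in> SO_set"
  shows "transpose A ** A = mat 1" "A ** transpose A = mat 1"
  using assms by (auto simp: SO_set_iff orthogonal_matrix_def)

lemma matrix_inv_SO:
  assumes "A \<in> SO_set"
  shows "matrix_inv A = transpose A"
proof -
  have "A ** matrix_inv A = mat 1"
    unfolding matrix_inv_def using someI[of "\<lambda>B. A ** B = mat 1 \<and> B ** A = mat 1" "transpose A"] assms
    by simp
  then have "transpose A ** A ** matrix_inv A = transpose A"
    by (simp flip: matrix_mul_assoc)
  then show ?thesis using assms by simp
qed

text \<open>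
  The determinant of an orthogonal matrix is \<open>1\<close> or \<open>-1\<close>, so it cannot change along a connected set.
  Explicit rotations have determinant \<open>1\<close> because they deform to the identity.
\<close>
lemma orthogonal_connected_imp_SO:
  fixes f :: "'a::real_normed_vector \<Rightarrow> real^'n^'n"
  assumes "connected U" "continuous_on U f" "\<And>x. x \<in> U \<Longrightarrow> orthogonal_matrix (f x)"
    and "a \<in> U" "det (f a) = 1" "x \<in> U"
  shows "f x \<in> SO_set"
proof -
  have "(\<lambda>x. det (f x)) ` U \<subseteq> {1, -1}"
    using assms(3) det_orthogonal_matrix by blast
  then have "finite ((\<lambda>x. det (f x)) ` U)"
    using finite_subset by blast
  then have "(\<lambda>x. det (f x)) constant_on U"
    using assms by (intro continuous_finite_range_constant continuous_intros)
  then show ?thesis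
    using assms unfolding constant_on_def SO_set_iff by metis
qed

lemma matrix_vector_mult_minus_left: "(- A) *v x = - (A *v (x :: real^'n))"
  by (simp add: vec_eq_iff matrix_vector_mult_def sum_negf)

lemma matrix_mult_minus_left: "(- A) ** B = - (A ** (B :: real^'n^'n))"
  by (simp add: vec_eq_iff matrix_matrix_mult_def sum_negf)

lemma matrix_mult_minus_right: "A ** (- B) = - (A ** (B :: real^'n^'n))"
  by (simp add: vec_eq_iff matrix_matrix_mult_def sum_negf)

section \<open>Homotopies of paths of rotations\<close>

abbreviation path_homotopic (infix "\<simeq>" 50) where
  "p \<simeq> q \<equiv> homotopic_paths SO_set p q"

text \<open>
  The curried form of a homotopy with fixed endpoints; it makes the homotopy available as a term, so
  that homotopies can be multiplied, conjugated and lifted pointwise.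
\<close>
definition path_homotopy ::
  "'a::topological_space set \<Rightarrow> (real \<Rightarrow> real \<Rightarrow> 'a) \<Rightarrow> (real \<Rightarrow> 'a) \<Rightarrow> (real \<Rightarrow> 'a) \<Rightarrow> bool" where
  "path_homotopy S h p q \<longleftrightarrow>
     continuous_on ({0..1} \<times> {0..1}) (\<lambda>z. h (fst z) (snd z)) \<and>
     (\<forall>s\<in>{0..1}. \<forall>t\<in>{0..1}. h s t \<in> S) \<and>
     (\<forall>t\<in>{0..1}. h 0 t = p t \<and> h 1 t = q t) \<and>
     (\<forall>s\<in>{0..1}. h s 0 = p 0 \<and> h s 1 = p 1)"

lemma homotopic_paths_iff: "homotopic_paths S p q \<longleftrightarrow> (\<exists>h. path_homotopy S h p q)"
proof
  assume "homotopic_paths S p q"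
  then obtain h where "continuous_on ({0..1} \<times> {0..1}) h" "h \<in> ({0..1} \<times> {0..1}) \<rightarrow> S"
      "\<forall>x\<in>{0..1}. h (0, x) = p x" "\<forall>x\<in>{0..1}. h (1, x) = q x"
      "\<forall>t\<in>{0..1::real}. pathstart (h \<circ> Pair t) = pathstart p \<and> pathfinish (h \<circ> Pair t) = pathfinish p"
    unfolding homotopic_paths by auto
  then have "path_homotopy S (\<lambda>s t. h (s, t)) p q"
    by (auto simp: path_homotopy_def pathstart_def pathfinish_def)
  then show "\<exists>h. path_homotopy S h p q" by blast
next
  assume "\<exists>h. path_homotopy S h p q"
  then obtain h where "path_homotopy S h p q" by blast
  then show "homotopic_paths S p q"
    unfolding homotopic_paths path_homotopy_def
    by (intro exI[of _ "\<lambda>z. h (fst z) (snd z)"]) (auto simp: pathstart_def pathfinish_def)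
qed

lemma homotopic_pathsI:
  fixes h :: "real \<Rightarrow> real \<Rightarrow> 'a::topological_space"
  assumes "continuous_on ({0..1} \<times> {0..1}) (\<lambda>z. h (fst z) (snd z))"
    and "\<And>s t. s \<in> {0..1} \<Longrightarrow> t \<in> {0..1} \<Longrightarrow> h s t \<in> S"
    and "\<And>t. t \<in> {0..1} \<Longrightarrow> h 0 t = p t" "\<And>t. t \<in> {0..1} \<Longrightarrow> h 1 t = q t"
    and "\<And>s. s \<in> {0..1} \<Longrightarrow> h s 0 = p 0" "\<And>s. s \<in> {0..1} \<Longrightarrow> h s 1 = p 1"
  shows "homotopic_paths S p q"
  unfolding homotopic_paths_iff path_homotopy_def using assms by (intro exI[of _ h]) blast

lemma path_homotopyD:
  assumes "path_homotopy S h p q"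
  shows "continuous_on ({0..1} \<times> {0..1}) (\<lambda>z. h (fst z) (snd z))"
    and "\<And>s t. s \<in> {0..1} \<Longrightarrow> t \<in> {0..1} \<Longrightarrow> h s t \<in> S"
    and "\<And>t. t \<in> {0..1} \<Longrightarrow> h 0 t = p t" "\<And>t. t \<in> {0..1} \<Longrightarrow> h 1 t = q t"
    and "\<And>s. s \<in> {0..1} \<Longrightarrow> h s 0 = p 0" "\<And>s. s \<in> {0..1} \<Longrightarrow> h s 1 = p 1"
  using assms unfolding path_homotopy_def by blast+

lemma path_mult:
  fixes p q :: "real \<Rightarrow> real^'n^'n"
  shows "path p \<Longrightarrow> path q \<Longrightarrow> path (\<lambda>t. p t ** q t)"
  unfolding path_def by (intro continuous_intros)

lemma path_image_mult:
  fixes p q :: "real \<Rightarrow> real^'n^'n"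
  shows "path_image p \<subseteq> SO_set \<Longrightarrow> path_image q \<subseteq> SO_set \<Longrightarrow> path_image (\<lambda>t. p t ** q t) \<subseteq> SO_set"
  unfolding path_image_def by (auto intro!: SO_mult)

lemma path_homotopic_mult:
  fixes p q :: "real \<Rightarrow> real^'n^'n"
  assumes "p \<simeq> p'" "q \<simeq> q'"
  shows "(\<lambda>t. p t ** q t) \<simeq> (\<lambda>t. p' t ** q' t)"
proof -
  obtain h k where "path_homotopy SO_set h p p'" "path_homotopy SO_set k q q'"
    using assms unfolding homotopic_paths_iff by blast
  note h = path_homotopyD[OF this(1)] and k = path_homotopyD[OF this(2)]
  show ?thesis
  proof (rule homotopic_pathsI[of "\<lambda>s t. h s t ** k s t"])
    show "continuous_on ({0..1} \<times> {0..1}) (\<lambda>z. h (fst z) (snd z) ** k (fst z) (snd z))"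
      by (intro continuous_on_matrix_mult h k)
  qed (simp_all add: h k SO_mult)
qed

text \<open>
  Pad \<open>p\<close> with a constant path at its end and \<open>q\<close> with one at its start: the pointwise product of the
  padded paths is exactly the concatenation, and the padding does not change the homotopy classes.
\<close>
lemma join_path_homotopic_mult:
  fixes p q :: "real \<Rightarrow> real^'n^'n"
  assumes "path p" "path_image p \<subseteq> SO_set" "path q" "path_image q \<subseteq> SO_set"
    and "pathfinish p = mat 1" "pathstart q = mat 1"
  shows "p +++ q \<simeq> (\<lambda>t. p t ** q t)"
proof -
  let ?one = "linepath (mat 1) (mat 1) :: real \<Rightarrow> real^'n^'n"
  have "(p +++ q) t = (p +++ ?one) t ** (?one +++ q) t" for t
    by (simp add: joinpaths_def linepath_refl)
  then have eq: "(\<lambda>t. (p +++ ?one) t ** (?one +++ q) t) = p +++ q" by (simp add: fun_eq_iff)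
  have "(\<lambda>t. (p +++ ?one) t ** (?one +++ q) t) \<simeq> (\<lambda>t. p t ** q t)"
    using assms by (intro path_homotopic_mult homotopic_paths_rid' homotopic_paths_lid') auto
  then show ?thesis by (simp only: eq)
qed

text \<open>
  The endpoints of \<open>\<beta>\<close> are the identity, which every conjugation fixes, so conjugating by a family
  that starts at the identity is a homotopy with fixed endpoints. The conjugating matrix
  may depend on \<open>t\<close> as well; this is what allows factors to be interchanged up to homotopy.
\<close>
lemma loop_path_homotopic_conj_family:
  fixes \<beta> :: "real \<Rightarrow> real^'n^'n" and C :: "real \<Rightarrow> real \<Rightarrow> real^'n^'n"
  assumes \<beta>: "\<beta> \<in> loops SO_set (mat 1)"
    and C: "continuous_on ({0..1} \<times> {0..1}) (\<lambda>z. C (fst z) (snd z))"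
      "\<And>s t. s \<in> {0..1} \<Longrightarrow> t \<in> {0..1} \<Longrightarrow> C s t \<in> SO_set"
      "\<And>t. t \<in> {0..1} \<Longrightarrow> C 0 t = mat 1"
  shows "\<beta> \<simeq> (\<lambda>t. C 1 t ** \<beta> t ** transpose (C 1 t))"
proof (rule homotopic_pathsI[of "\<lambda>s t. C s t ** \<beta> t ** transpose (C s t)"])
  have \<beta>S: "\<beta> s \<in> SO_set" if "s \<in> {0..1}" for s
    using \<beta> that by (auto simp: path_image_def loops_def)
  have "continuous_on {0..1} \<beta>"
    using \<beta> by (auto simp: loops_def path_def)
  then have "continuous_on ({0..1} \<times> {0..1}) (\<lambda>z::real\<times>real. \<beta> (snd z))"
    by (rule continuous_on_compose2[OF _ continuous_on_snd[OF continuous_on_id]]) auto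
  then show "continuous_on ({0..1} \<times> {0..1})
      (\<lambda>z. C (fst z) (snd z) ** \<beta> (snd z) ** transpose (C (fst z) (snd z)))"
    by (intro continuous_intros C(1))
  have "\<beta> 0 = mat 1" "\<beta> 1 = mat 1" using \<beta> by (auto simp: loops_def pathstart_def pathfinish_def)
  then show "C s 0 ** \<beta> 0 ** transpose (C s 0) = \<beta> 0" "C s 1 ** \<beta> 1 ** transpose (C s 1) = \<beta> 1"
    if "s \<in> {0..1}" for s
    using C(2) that by simp_all
  show "C s t ** \<beta> t ** transpose (C s t) \<in> SO_set" if "s \<in> {0..1}" "t \<in> {0..1}" for s t
    using C(2) \<beta>S that by (intro SO_mult SO_transpose)
qed (use C(3) in \<open>auto simp: transpose_mat\<close>)

section \<open>Rotations of a coordinate plane and full turns\<close>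

definition rot :: "'n \<Rightarrow> 'n \<Rightarrow> real \<Rightarrow> real^'n^'n" where
  "rot a b \<theta> = (\<chi> i j.
     if i = a then (if j = a then cos \<theta> else if j = b then - sin \<theta> else 0)
     else if i = b then (if j = a then sin \<theta> else if j = b then cos \<theta> else 0)
     else if i = j then 1 else 0)"

lemma rot_vec:
  assumes "a \<noteq> b"
  shows "(rot a b \<theta> *v x) $ i =
     (if i = a then cos \<theta> * x $ a - sin \<theta> * x $ b
      else if i = b then sin \<theta> * x $ a + cos \<theta> * x $ b else x $ i)"
proof -
  have "(rot a b \<theta> *v x) $ i = (\<Sum>j\<in>UNIV.
     (if j = a then (if i = a then cos \<theta> * x $ a else if i = b then sin \<theta> * x $ a else 0) else 0)
     + (if j = b then (if i = a then - sin \<theta> * x $ b else if i = b then cos \<theta> * x $ b else 0) else 0)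
     + (if j = i then (if i = a \<or> i = b then 0 else x $ i) else 0))"
    unfolding matrix_vector_mult_def vec_lambda_beta
    by (rule sum.cong) (use assms in \<open>auto simp: rot_def\<close>)
  then show ?thesis
    using assms by (simp add: sum.distrib)
qed

lemma rot_0 [simp]: "a \<noteq> b \<Longrightarrow> rot a b 0 = mat 1"
  by (simp add: matrix_eq vec_eq_iff rot_vec)

lemma rot_add:
  assumes "a \<noteq> b"
  shows "rot a b \<theta> ** rot a b \<phi> = rot a b (\<theta> + \<phi>)"
  using assms by (auto simp: matrix_eq vec_eq_iff rot_vec cos_add sin_add algebra_simps simp flip: matrix_vector_mul_assoc)

lemma rot_flip: "a \<noteq> b \<Longrightarrow> rot b a \<theta> = rot a b (- \<theta>)"
  by (auto simp: rot_def vec_eq_iff)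

lemma transpose_rot: "a \<noteq> b \<Longrightarrow> transpose (rot a b \<theta>) = rot a b (- \<theta>)"
  by (auto simp: rot_def transpose_def vec_eq_iff)

lemma continuous_on_rot [continuous_intros]:
  assumes "continuous_on S f"
  shows "continuous_on S (\<lambda>x. rot a b (f x))"
proof -
  have "continuous_on UNIV (\<lambda>\<theta>. rot a b \<theta> $ i $ j)" for i j
    by (cases "i = a"; cases "j = a"; cases "i = b"; cases "j = b"; cases "i = j")
      (simp_all add: rot_def continuous_on_cos continuous_on_sin continuous_on_minus)
  then have "continuous_on UNIV (\<lambda>\<theta>. \<chi> i j. rot a b \<theta> $ i $ j)"
    by (intro continuous_on_vec_lambda)
  then have "continuous_on UNIV (rot a b)" by simp
  then show ?thesis using assms continuous_on_compose2 by blast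
qed

lemma orthogonal_rot: "a \<noteq> b \<Longrightarrow> orthogonal_matrix (rot a b \<theta>)"
  by (simp add: orthogonal_matrix_def transpose_rot rot_add)

lemma rot_SO [simp]: "a \<noteq> b \<Longrightarrow> rot a b \<theta> \<in> SO_set"
  by (rule orthogonal_connected_imp_SO[of UNIV "rot a b" 0])
    (auto simp: orthogonal_rot intro!: continuous_intros)

text \<open>The half turn in the plane of \<open>b\<close> and \<open>c\<close> fixes the axis \<open>a\<close> and reverses the axis \<open>b\<close>.\<close>
lemma rot_flip_conj:
  assumes "a \<noteq> b" "c \<noteq> a" "c \<noteq> b"
  shows "rot b c pi ** rot a b \<theta> ** transpose (rot b c pi) = rot a b (- \<theta>)"
proof -
  have "rot b c pi ** rot a b \<theta> = rot a b (- \<theta>) ** rot b c pi"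
    using assms by (auto simp: matrix_eq vec_eq_iff rot_vec simp flip: matrix_vector_mul_assoc)
  then show ?thesis using assms by (simp flip: matrix_mul_assoc)
qed

text \<open>The quarter turn in the plane of \<open>b\<close> and \<open>c\<close> fixes the axis \<open>a\<close> and takes the axis \<open>b\<close> to \<open>c\<close>.\<close>
lemma rot_move_conj:
  assumes "a \<noteq> b" "c \<noteq> a" "c \<noteq> b"
  shows "rot b c (pi/2) ** rot a b \<theta> ** transpose (rot b c (pi/2)) = rot a c \<theta>"
proof -
  have "rot b c (pi/2) ** rot a b \<theta> = rot a c \<theta> ** rot b c (pi/2)"
    using assms by (auto simp: matrix_eq vec_eq_iff rot_vec simp flip: matrix_vector_mul_assoc)
  then show ?thesis using assms by (simp flip: matrix_mul_assoc)
qed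

definition turns :: "'n \<Rightarrow> 'n \<Rightarrow> int \<Rightarrow> real \<Rightarrow> real^'n^'n" where
  "turns a b m t = rot a b (2 * pi * of_int m * t)"

lemma rot_angle_loop:
  assumes "a \<noteq> b" "continuous_on {0..1} \<theta>" "\<theta> 0 = 0" "\<theta> 1 = 2 * pi * of_int m"
  shows "(\<lambda>t. rot a b (\<theta> t)) \<in> loops SO_set (mat 1)"
proof -
  have "rot a b (2 * pi * of_int m) = rot a b 0"
    by (auto simp: rot_def vec_eq_iff)
  then show ?thesis
    using assms unfolding loops_def path_def path_image_def pathstart_def pathfinish_def
    by (auto intro!: continuous_intros)
qed

lemma turns_loop: "a \<noteq> b \<Longrightarrow> turns a b m \<in> loops SO_set (mat 1)"
  unfolding turns_def by (rule rot_angle_loop) (auto intro!: continuous_intros)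

lemma turns_refl: "a \<noteq> b \<Longrightarrow> turns a b m \<simeq> turns a b m"
  using turns_loop[of a b m] by (auto simp: loops_def)

text \<open>Interpolate linearly between the angle functions; all of them have the same end values.\<close>
lemma rot_angle_homotopic_turns:
  assumes "a \<noteq> b" "continuous_on {0..1} \<theta>" "\<theta> 0 = 0" "\<theta> 1 = 2 * pi * of_int m"
  shows "(\<lambda>t. rot a b (\<theta> t)) \<simeq> turns a b m"
proof (rule homotopic_pathsI[of "\<lambda>s t. rot a b ((1 - s) * \<theta> t + s * (2 * pi * of_int m * t))"])
  have "continuous_on ({0..1} \<times> {0..1}) (\<lambda>z :: real \<times> real. \<theta> (snd z))"
    by (rule continuous_on_compose2[OF assms(2) continuous_on_snd[OF continuous_on_id]]) auto
  then show "continuous_on ({0..1} \<times> {0..1})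
      (\<lambda>z. rot a b ((1 - fst z) * \<theta> (snd z) + fst z * (2 * pi * of_int m * snd z)))"
    by (intro continuous_intros)
  show "rot a b ((1 - s) * \<theta> 1 + s * (2 * pi * of_int m * 1)) = rot a b (\<theta> 1)" for s
    using assms by (simp add: algebra_simps)
qed (use assms in \<open>auto simp: turns_def\<close>)

lemma turns_add: "a \<noteq> b \<Longrightarrow> turns a b m t ** turns a b n t = turns a b (m + n) t"
  by (simp add: turns_def rot_add algebra_simps)

lemma turns_0: "a \<noteq> b \<Longrightarrow> turns a b 0 = (\<lambda>t. mat 1)"
  by (simp add: turns_def fun_eq_iff)

lemma turns_flip: "a \<noteq> b \<Longrightarrow> turns b a m = turns a b (- m)"
  by (simp add: turns_def fun_eq_iff rot_flip[of a b])

lemma loop_path_homotopic_conj_rot: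
  fixes \<beta> :: "real \<Rightarrow> real^'n^'n"
  assumes "\<beta> \<in> loops SO_set (mat 1)" "b \<noteq> c"
  shows "\<beta> \<simeq> (\<lambda>t. rot b c \<phi> ** \<beta> t ** transpose (rot b c \<phi>))"
proof -
  have "continuous_on ({0..1} \<times> {0..1}) (\<lambda>z::real\<times>real. rot b c (\<phi> * fst z))"
    by (intro continuous_intros)
  from loop_path_homotopic_conj_family[OF assms(1), of "\<lambda>s t. rot b c (\<phi> * s)", OF this] show ?thesis
    using assms(2) by simp
qed

lemma turns_reverse:
  assumes "a \<noteq> b" "c \<noteq> a" "c \<noteq> b"
  shows "turns a b m \<simeq> turns a b (- m)"
  using loop_path_homotopic_conj_rot[OF turns_loop[OF assms(1), of m], of b c pi] assms
  by (simp add: turns_def[abs_def] rot_flip_conj)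

lemma turns_move:
  assumes "a \<noteq> b" "c \<noteq> a" "c \<noteq> b"
  shows "turns a b m \<simeq> turns a c m"
  using loop_path_homotopic_conj_rot[OF turns_loop[OF assms(1), of m], of b c "pi/2"] assms
  by (simp add: turns_def[abs_def] rot_move_conj)

text \<open>
  This is where the fundamental group acquires torsion: with a third axis \<open>c\<close> at hand a number of
  turns is homotopic to the same number of turns backwards, so twice that number cancels.
\<close>
lemma turns_even:
  assumes "a \<noteq> b" "c \<noteq> a" "c \<noteq> b"
  shows "turns a b (2 * m) \<simeq> (\<lambda>_. mat 1)"
proof -
  have "(\<lambda>t. turns a b m t ** turns a b m t) \<simeq> (\<lambda>t. turns a b m t ** turns a b (- m) t)"
    by (intro path_homotopic_mult turns_refl turns_reverse[OF assms] assms(1))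
  then show ?thesis
    using assms by (simp add: turns_add turns_0)
qed

lemma turns_odd:
  assumes "a \<noteq> b" "c \<noteq> a" "c \<noteq> b"
  shows "turns a b (2 * m + 1) \<simeq> turns a b 1"
proof -
  have "(\<lambda>t. turns a b (2 * m) t ** turns a b 1 t) \<simeq> (\<lambda>t. mat 1 ** turns a b 1 t)"
    by (intro path_homotopic_mult turns_refl turns_even[OF assms] assms(1))
  then show ?thesis
    using assms by (simp add: turns_add)
qed

lemma obtain_third_index:
  fixes a b :: "'n::finite"
  assumes "CARD('n) \<ge> 3"
  obtains c where "c \<noteq> a" "c \<noteq> b"
proof -
  have "card {a, b} \<le> 2" by (simp add: card_insert_if)
  then have "{a, b} \<noteq> UNIV" using assms by (metis not_less_eq_eq numeral_2_eq_2 numeral_3_eq_3 order_trans)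
  then show thesis using that by auto
qed

lemma turns_any_plane:
  fixes a b c d :: "'n::finite"
  assumes n: "CARD('n) \<ge> 3" and "a \<noteq> b" "c \<noteq> d"
  shows "turns a b 1 \<simeq> turns c d 1"
proof (cases "c = a")
  case True
  then show ?thesis using assms by (metis turns_move turns_refl)
next
  case False
  have 1: "turns a b 1 \<simeq> turns a c 1"
    using assms False by (metis turns_move turns_refl)
  obtain e where "e \<noteq> c" "e \<noteq> a" by (rule obtain_third_index[OF n])
  then have 2: "turns a c 1 \<simeq> turns c a 1"
    using turns_reverse[of a c e 1] False turns_flip[of a c 1] by simp
  have 3: "turns c a 1 \<simeq> turns c d 1"
    using assms False by (metis turns_move turns_refl)
  show ?thesis using 1 2 3 homotopic_paths_trans by blast
qed

section \<open>Lifting a contraction of an orbit on the sphere\<close>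

text \<open>
  The product of the reflections along \<open>u\<close> and along \<open>u + v\<close>. For unit vectors that are not antipodal
  it is the rotation in the plane of \<open>u\<close> and \<open>v\<close> which takes \<open>u\<close> to \<open>v\<close> and fixes the orthogonal
  complement of that plane. It depends continuously on \<open>u\<close> and \<open>v\<close> and so provides local sections of
  the orbit map from the group to the sphere.
\<close>
definition min_rot :: "real^'n \<Rightarrow> real^'n \<Rightarrow> real^'n^'n" where
  "min_rot u v = (\<chi> i j. (if i = j then 1 else 0)
     - (u + v) $ i * (u + v) $ j / (1 + u \<bullet> v) + 2 * v $ i * u $ j)"

lemma min_rot_vec:
  "min_rot u v *v x = x - ((u + v) \<bullet> x / (1 + u \<bullet> v)) *\<^sub>R (u + v) + (2 * (u \<bullet> x)) *\<^sub>R v"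
proof -
  have "(min_rot u v *v x) $ i = (\<Sum>j\<in>UNIV. (if j = i then x $ i else 0)
     - (u + v) $ i / (1 + u \<bullet> v) * ((u + v) $ j * x $ j) + 2 * v $ i * (u $ j * x $ j))" for i
    unfolding matrix_vector_mult_def min_rot_def vec_lambda_beta
    by (rule sum.cong) (auto simp: algebra_simps add_divide_distrib)
  then have "(min_rot u v *v x) $ i = x $ i - (u + v) $ i / (1 + u \<bullet> v) * ((u + v) \<bullet> x)
     + 2 * v $ i * (u \<bullet> x)" for i
    by (simp add: sum.distrib sum_subtractf sum_distrib_left inner_vec_def)
  then show ?thesis
    by (simp add: vec_eq_iff)
qed

lemma min_rot_same:
  assumes "norm u = 1"
  shows "min_rot u u = mat 1"
proof -
  have "u \<bullet> u = 1" using assms by (simp add: dot_square_norm)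
  then show ?thesis
    by (simp add: matrix_eq min_rot_vec flip: scaleR_2)
qed

lemma min_rot_maps:
  assumes "norm u = 1" "1 + u \<bullet> v \<noteq> 0"
  shows "min_rot u v *v u = v"
proof -
  have "u \<bullet> u = 1" using assms by (simp add: dot_square_norm)
  then have eq: "((u + v) \<bullet> u / (1 + u \<bullet> v)) = 1"
    using assms(2) \<open>u \<bullet> u = 1\<close> by (simp add: inner_left_distrib inner_right_distrib inner_commute[of v u])
  then show ?thesis
    unfolding min_rot_vec eq using \<open>u \<bullet> u = 1\<close> by (simp add: scaleR_2)
qed

lemma min_rot_fixes:
  assumes "u \<bullet> w = 0" "v \<bullet> w = 0"
  shows "min_rot u v *v w = w"
  using assms by (simp add: min_rot_vec inner_left_distrib)

lemma orthogonal_min_rot: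
  assumes "norm u = 1" "norm v = 1" "1 + u \<bullet> v \<noteq> 0"
  shows "orthogonal_matrix (min_rot u v)"
proof -
  have "norm (min_rot u v *v x) = norm x" for x
  proof -
    have uu: "u \<bullet> u = 1" and vv: "v \<bullet> v = 1" using assms by (auto simp: dot_square_norm)
    \<comment> \<open>The squared length of \<open>u + v\<close> is \<open>2 d\<close>, so the reflection along \<open>u + v\<close> has denominator \<open>d\<close>.\<close>
    define d where "d = 1 + u \<bullet> v"
    define \<alpha> where "\<alpha> = (u \<bullet> x + v \<bullet> x) / d"
    have \<alpha>: "\<alpha> * d = u \<bullet> x + v \<bullet> x" using assms(3) by (simp add: \<alpha>_def d_def)
    have uv: "u \<bullet> v = d - 1" by (simp add: d_def)
    have eq: "min_rot u v *v x = x - \<alpha> *\<^sub>R (u + v) + (2 * (u \<bullet> x)) *\<^sub>R v"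
      by (simp add: min_rot_vec \<alpha>_def d_def inner_left_distrib)
    have "(min_rot u v *v x) \<bullet> (min_rot u v *v x) =
      x \<bullet> x + 2 * \<alpha> * (\<alpha> * d) + 4 * (u \<bullet> x)\<^sup>2 - 2 * \<alpha> * (u \<bullet> x + v \<bullet> x) + 4 * (u \<bullet> x) * (v \<bullet> x)
        - 4 * (u \<bullet> x) * (\<alpha> * d)"
      unfolding eq by (simp add: inner_simps uu vv uv inner_commute[of v u] inner_commute[of x u] inner_commute[of x v]
          algebra_simps power2_eq_square)
    then have "(min_rot u v *v x) \<bullet> (min_rot u v *v x) = x \<bullet> x"
      unfolding \<alpha> by (simp add: algebra_simps power2_eq_square)
    then show ?thesis by (simp add: norm_eq_sqrt_inner)
  qed
  then have "orthogonal_transformation ((*v) (min_rot u v))"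
    by (simp add: orthogonal_transformation)
  then show ?thesis
    by (simp add: orthogonal_transformation_matrix)
qed

lemma continuous_on_min_rot [continuous_intros]:
  fixes f g :: "'a::topological_space \<Rightarrow> real^'n"
  assumes "continuous_on S f" "continuous_on S g" "\<And>x. x \<in> S \<Longrightarrow> 1 + f x \<bullet> g x \<noteq> 0"
  shows "continuous_on S (\<lambda>x. min_rot (f x) (g x))"
proof -
  have "continuous_on S (\<lambda>x. if (i::'n) = j then 1 else 0 :: real)" for i j
    by (rule continuous_on_const)
  then show ?thesis
    unfolding min_rot_def using assms by (intro continuous_intros) auto
qed

lemma unit_vectors_not_antipodal:
  fixes u v :: "'a::real_inner"
  assumes "norm u = 1" "norm v = 1" "dist u v < 2"
  shows "1 + u \<bullet> v \<noteq> 0"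
proof
  assume "1 + u \<bullet> v = 0"
  moreover have "u \<bullet> u = 1" "v \<bullet> v = 1" using assms by (auto simp: dot_square_norm)
  ultimately have "(u - v) \<bullet> (u - v) = 4" by (simp add: inner_diff inner_commute)
  then have "dist u v = 2" by (simp add: dist_norm norm_eq_sqrt_inner)
  then show False using assms by simp
qed

lemma matrix_vector_inner_SO:
  assumes "A \<in> SO_set"
  shows "(A *v x) \<bullet> (A *v y) = x \<bullet> y"
proof -
  have "(A *v x) \<bullet> (A *v y) = (transpose A *v (A *v x)) \<bullet> y"
    by (metis dot_lmul_matrix transpose_matrix_vector)
  then show ?thesis using assms by (simp add: matrix_vector_mul_assoc)
qed

text \<open>
  As long as \<open>F s t\<close> stays closer than \<open>2\<close> to \<open>F 0 t\<close>, the two unit vectors are not antipodal and the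
  rotation between them depends continuously on \<open>s\<close> and \<open>t\<close>. At \<open>t = 0\<close> and \<open>t = 1\<close> the vector does
  not move and the rotation is the identity.
\<close>
lemma lift_short_homotopy:
  fixes F :: "real \<Rightarrow> real \<Rightarrow> real^'n"
  assumes A: "A \<in> loops SO_set (mat 1)"
    and F: "continuous_on ({0..1} \<times> {0..1}) (\<lambda>z. F (fst z) (snd z))"
    and unit: "\<And>s t. s \<in> {0..1} \<Longrightarrow> t \<in> {0..1} \<Longrightarrow> norm (F s t) = 1"
    and short: "\<And>s t. s \<in> {0..1} \<Longrightarrow> t \<in> {0..1} \<Longrightarrow> dist (F 0 t) (F s t) < 2"
    and ends: "\<And>s. s \<in> {0..1} \<Longrightarrow> F s 0 = F 0 0" "\<And>s. s \<in> {0..1} \<Longrightarrow> F s 1 = F 0 1"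
  shows "A \<simeq> (\<lambda>t. min_rot (F 0 t) (F 1 t) ** A t)"
proof (rule homotopic_pathsI[of "\<lambda>s t. min_rot (F 0 t) (F s t) ** A t"])
  have nz: "1 + F 0 t \<bullet> F s t \<noteq> 0" if "s \<in> {0..1}" "t \<in> {0..1}" for s t
    using that by (intro unit_vectors_not_antipodal unit short) auto
  have F0: "continuous_on ({0..1} \<times> {0..1}) (\<lambda>z::real\<times>real. F 0 (snd z))"
  proof -
    have "continuous_on ({0..1} \<times> {0..1}) (\<lambda>z::real\<times>real. F (fst (0::real, snd z)) (snd (0::real, snd z)))"
      by (rule continuous_on_compose2[OF F]) (auto intro!: continuous_intros)
    then show ?thesis by simp
  qed
  have contR: "continuous_on ({0..1} \<times> {0..1}) (\<lambda>z::real\<times>real. min_rot (F 0 (snd z)) (F (fst z) (snd z)))"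
    by (intro continuous_intros F F0 nz) auto
  have SO_A: "A t \<in> SO_set" if "t \<in> {0..1}" for t
    using A that by (auto simp: loops_def path_image_def)
  have "continuous_on {0..1} A" using A by (simp add: loops_def path_def)
  then have "continuous_on ({0..1} \<times> {0..1}) (\<lambda>z::real\<times>real. A (snd z))"
    by (rule continuous_on_compose2[OF _ continuous_on_snd[OF continuous_on_id]]) auto
  then show "continuous_on ({0..1} \<times> {0..1}) (\<lambda>z. min_rot (F 0 (snd z)) (F (fst z) (snd z)) ** A (snd z))"
    by (intro continuous_intros contR)
  have "min_rot (F 0 t) (F s t) \<in> SO_set" if "s \<in> {0..1}" "t \<in> {0..1}" for s t
  proof -
    have con: "connected ({0..1::real} \<times> {0..1::real})"
      by (intro convex_connected convex_Times) auto
    have "min_rot (F 0 (snd (s,t))) (F (fst (s,t)) (snd (s,t))) \<in> SO_set"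
      by (rule orthogonal_connected_imp_SO[OF con contR, where a = "(0,0)"])
        (use that unit nz in \<open>auto simp: min_rot_same intro!: orthogonal_min_rot\<close>)
    then show ?thesis by simp
  qed
  then show "min_rot (F 0 t) (F s t) ** A t \<in> SO_set" if "s \<in> {0..1}" "t \<in> {0..1}" for s t
    using that SO_A by (intro SO_mult) auto
  show "min_rot (F 0 t) (F 0 t) ** A t = A t" if "t \<in> {0..1}" for t
    using that by (simp add: min_rot_same unit)
  show "min_rot (F 0 0) (F s 0) ** A 0 = A 0" "min_rot (F 0 1) (F s 1) ** A 1 = A 1" if "s \<in> {0..1}" for s
    using that ends(1)[OF that] ends(2)[OF that] by (simp_all add: min_rot_same unit)
qed auto

lemma loops_homotopic:
  assumes "p \<in> loops S a" "homotopic_paths S p q"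
  shows "q \<in> loops S a"
  using assms homotopic_paths_imp_path homotopic_paths_imp_subset homotopic_paths_imp_pathstart
    homotopic_paths_imp_pathfinish unfolding loops_def by (smt (verit) mem_Collect_eq)

text \<open>
  The homotopy lifting property of the orbit map \<open>A \<mapsto> A e\<close>. By uniform continuity \<open>F\<close> is a
  succession of short homotopies, which are lifted one at a time. The vectors in \<open>W\<close> are orthogonal to
  \<open>F\<close> and therefore remain fixed, so that the lift can be used inside a stabilizer.
\<close>
lemma lift_homotopy:
  fixes F :: "real \<Rightarrow> real \<Rightarrow> real^'n"
  assumes A: "A \<in> loops SO_set (mat 1)"
    and F: "continuous_on ({0..1} \<times> {0..1}) (\<lambda>z. F (fst z) (snd z))"
    and unit: "\<And>s t. s \<in> {0..1} \<Longrightarrow> t \<in> {0..1} \<Longrightarrow> norm (F s t) = 1"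
    and ends: "\<And>s. s \<in> {0..1} \<Longrightarrow> F s 0 = e" "\<And>s. s \<in> {0..1} \<Longrightarrow> F s 1 = e"
    and start: "\<And>t. t \<in> {0..1} \<Longrightarrow> A t *v e = F 0 t"
    and W: "\<And>w t. w \<in> W \<Longrightarrow> t \<in> {0..1} \<Longrightarrow> A t *v w = w"
      "\<And>w s t. w \<in> W \<Longrightarrow> s \<in> {0..1} \<Longrightarrow> t \<in> {0..1} \<Longrightarrow> F s t \<bullet> w = 0"
  obtains B where "A \<simeq> B" "\<And>t. t \<in> {0..1} \<Longrightarrow> B t *v e = F 1 t"
    "\<And>w t. w \<in> W \<Longrightarrow> t \<in> {0..1} \<Longrightarrow> B t *v w = w"
proof -
  have "compact ({0..1::real} \<times> {0..1::real})" by (intro compact_Times) auto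
  then have "uniformly_continuous_on ({0..1} \<times> {0..1}) (\<lambda>z. F (fst z) (snd z))"
    using F compact_uniformly_continuous by blast
  then obtain d where "d > 0" and d: "\<And>z z'. z \<in> {0..1} \<times> {0..1} \<Longrightarrow> z' \<in> {0..1} \<times> {0..1} \<Longrightarrow>
      dist z' z < d \<Longrightarrow> dist (F (fst z') (snd z')) (F (fst z) (snd z)) < 2"
    unfolding uniformly_continuous_on_def by (meson zero_less_numeral)
  obtain N :: nat where N: "1 / real (Suc N) < d"
    using nat_approx_posE[OF \<open>d > 0\<close>] by blast
  define M where "M = Suc N"
  have M: "0 < real M" "1 / real M < d" using N by (auto simp: M_def)
  have "n \<le> M \<Longrightarrow> \<exists>B. A \<simeq> B \<and> (\<forall>t\<in>{0..1}. B t *v e = F (n / M) t) \<and> (\<forall>w\<in>W. \<forall>t\<in>{0..1}. B t *v w = w)" for n :: nat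
  proof (induction n)
    case 0
    have "A \<simeq> A" using A by (simp add: loops_def)
    then show ?case using start W(1) by (intro exI[of _ A]) auto
  next
    case (Suc n)
    then obtain B where B: "A \<simeq> B" "\<And>t. t \<in> {0..1} \<Longrightarrow> B t *v e = F (n / M) t"
      "\<And>w t. w \<in> W \<Longrightarrow> t \<in> {0..1} \<Longrightarrow> B t *v w = w"
      by auto
    \<comment> \<open>The \<open>n\<close>-th of the \<open>M\<close> short pieces of \<open>F\<close>, reparametrized by the unit interval.\<close>
    define G where "G = (\<lambda>s::real. F ((n + s) / M))"
    have in01: "(n + s) / M \<in> {0..1}" if "s \<in> {0..1}" for s :: real
      using that Suc.prems M(1) by (auto simp: divide_le_eq)
    have G1: "G 1 = F (Suc n / M)" and G0: "G 0 = F (n / M)" by (simp_all add: G_def add.commute)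
    have BG: "B \<simeq> (\<lambda>t. min_rot (G 0 t) (G 1 t) ** B t)"
    proof (rule lift_short_homotopy[where F = G])
      show "B \<in> loops SO_set (mat 1)" using loops_homotopic[OF A B(1)] .
      show "continuous_on ({0..1} \<times> {0..1}) (\<lambda>z. G (fst z) (snd z))"
        using continuous_on_compose2[OF F, of "{0..1} \<times> {0..1}" "\<lambda>z::real\<times>real. ((n + fst z) / M, snd z)"] M in01
        by (fastforce simp: G_def intro!: continuous_intros)
      show "dist (G 0 t) (G s t) < 2" if "s \<in> {0..1}" "t \<in> {0..1}" for s t
      proof -
        have "dist (n / M, t) ((n + s) / M, t) = s / M"
          using that M by (simp add: dist_Pair_Pair dist_real_def add_divide_distrib)
        also have "\<dots> < d" using that M by (smt (verit) atLeastAtMost_iff divide_right_mono)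
        finally have "dist (n / M, t) ((n + s) / M, t) < d" .
        from d[OF _ _ this] show ?thesis
          using in01[OF that(1)] in01[of 0] that by (auto simp: G_def)
      qed
    qed (use in01 in01[of 0] unit ends in \<open>auto simp: G_def\<close>)
    show ?case
    proof (intro exI[of _ "\<lambda>t. min_rot (G 0 t) (G 1 t) ** B t"] conjI ballI)
      show "A \<simeq> (\<lambda>t. min_rot (G 0 t) (G 1 t) ** B t)"
        using B(1) BG homotopic_paths_trans by blast
      show "(min_rot (G 0 t) (G 1 t) ** B t) *v e = F (Suc n / M) t" if "t \<in> {0..1}" for t
      proof -
        have "dist (n / M, t) ((n + 1) / M, t) < d"
          using that M by (simp add: dist_Pair_Pair dist_real_def add_divide_distrib)
        from d[OF _ _ this] have "dist (G 0 t) (G 1 t) < 2"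
          using in01[of 1] in01[of 0] that by (auto simp: G_def add.commute)
        then have "min_rot (G 0 t) (G 1 t) *v G 0 t = G 1 t"
          using in01[of 1] in01[of 0] that
          by (intro min_rot_maps unit_vectors_not_antipodal) (auto simp: G_def unit)
        then show ?thesis using B(2)[OF that] G0 G1 by (simp flip: matrix_vector_mul_assoc)
      qed
      show "(min_rot (G 0 t) (G 1 t) ** B t) *v w = w" if "w \<in> W" "t \<in> {0..1}" for w t
        using that in01[of 1] in01[of 0]
        by (simp add: B(3) min_rot_fixes W(2) G_def flip: matrix_vector_mul_assoc)
    qed
  qed
  from this[of M] M show thesis using that by auto
qed

text \<open>
  The unit sphere of the coordinate subspace on which the coordinates in \<open>S\<close> vanish; its dimension is
  at least two because \<open>a\<close>, \<open>b\<close> and \<open>c\<close> lie outside \<open>S\<close>.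
\<close>
lemma simply_connected_coordinate_sphere:
  fixes S :: "'n::finite set"
  assumes "a \<notin> S" "b \<notin> S" "c \<notin> S" "a \<noteq> b" "c \<noteq> a" "c \<noteq> b"
  shows "simply_connected {v :: real^'n. norm v = 1 \<and> (\<forall>i\<in>S. v $ i = 0)}"
proof -
  define T where "T = {v :: real^'n. \<forall>i\<in>S. v $ i = 0}"
  have subT: "subspace T" by (auto simp: T_def subspace_def)
  let ?B = "{axis a 1, axis b 1, axis c 1} :: (real^'n) set"
  have "?B \<subseteq> T" using assms by (auto simp: T_def axis_def)
  have "independent ?B"
    by (rule independent_mono[OF independent_Basis]) (auto simp: axis_in_Basis_iff)
  with \<open>?B \<subseteq> T\<close> have "card ?B \<le> dim T" using independent_card_le_dim by blast
  moreover have "card ?B = 3" using assms by (simp add: axis_eq_axis)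
  ultimately have "3 \<le> dim T" by simp
  have ne: "T \<inter> interior (cball 0 1) \<noteq> {}" using subspace_0[OF subT] by auto
  have "affine hull (T \<inter> cball 0 1) = affine hull T"
    by (rule affine_hull_convex_Int_nonempty_interior[OF subspace_imp_convex[OF subT] ne])
  then have "aff_dim (T \<inter> cball 0 1) = dim T"
    by (metis aff_dim_affine_hull aff_dim_subspace subT)
  then have "simply_connected (rel_frontier (T \<inter> cball 0 1))"
    using \<open>3 \<le> dim T\<close> convex_Int[OF subspace_imp_convex[OF subT] convex_cball]
    by (intro simply_connected_sphere_gen) (auto simp: bounded_Int)
  also have "rel_frontier (T \<inter> cball 0 1) = T \<inter> frontier (cball 0 1)"
    using ne convex_affine_rel_frontier_Int[of "cball 0 1" T] subspace_imp_affine[OF subT]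
    by (simp add: Int_commute)
  also have "\<dots> = {v. norm v = 1 \<and> (\<forall>i\<in>S. v $ i = 0)}"
    by (auto simp: T_def)
  finally show ?thesis .
qed

text \<open>
  Since \<open>A\<close> fixes the axes in \<open>S\<close>, the orbit of the axis \<open>c\<close> stays in their orthogonal complement. Its
  unit sphere is simply connected, and lifting a contraction of the orbit yields \<open>B\<close>.
\<close>
lemma loop_fix_axis:
  fixes A :: "real \<Rightarrow> real^'n^'n" and S :: "'n set"
  assumes A: "A \<in> loops SO_set (mat 1)"
    and fix_S: "\<And>i t. i \<in> S \<Longrightarrow> t \<in> {0..1} \<Longrightarrow> A t *v axis i 1 = axis i 1"
    and "a \<notin> S" "b \<notin> S" "c \<notin> S" "a \<noteq> b" "c \<noteq> a" "c \<noteq> b"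
  obtains B where "A \<simeq> B" "\<And>i t. i \<in> insert c S \<Longrightarrow> t \<in> {0..1} \<Longrightarrow> B t *v axis i 1 = axis i 1"
proof -
  let ?Sph = "{v :: real^'n. norm v = 1 \<and> (\<forall>i\<in>S. v $ i = 0)}"
  let ?e = "axis c 1 :: real^'n"
  define v where "v = (\<lambda>t. A t *v ?e)"
  have SO_A: "A t \<in> SO_set" if "t \<in> {0..1}" for t
    using A that by (auto simp: loops_def path_image_def)
  have ends: "A 0 = mat 1" "A 1 = mat 1" using A by (auto simp: loops_def pathstart_def pathfinish_def)
  have "path v"
    using A unfolding v_def path_def loops_def by (auto intro!: continuous_intros)
  moreover have "path_image v \<subseteq> ?Sph"
  proof -
    have "norm (v t) = 1" if "t \<in> {0..1}" for t
      unfolding v_def norm_eq_sqrt_inner matrix_vector_inner_SO[OF SO_A[OF that]] by (simp add: inner_axis_axis)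
    moreover have "v t $ i = 0" if "t \<in> {0..1}" "i \<in> S" for t i
    proof -
      have "v t $ i = v t \<bullet> axis i 1" by (simp add: inner_axis)
      also have "\<dots> = (A t *v ?e) \<bullet> (A t *v axis i 1)" using that fix_S by (simp add: v_def)
      also have "\<dots> = 0" using SO_A[OF that(1)] that \<open>c \<notin> S\<close> by (auto simp: matrix_vector_inner_SO inner_axis_axis)
      finally show ?thesis .
    qed
    ultimately show ?thesis by (auto simp: path_image_def)
  qed
  moreover have v_ends: "v 0 = ?e" "v 1 = ?e" using ends by (simp_all add: v_def)
  ultimately have "homotopic_paths ?Sph v (linepath ?e ?e)"
    using simply_connected_coordinate_sphere[OF assms(3-8)]
    unfolding simply_connected_eq_contractible_path by (auto simp: pathstart_def pathfinish_def)
  then obtain F where "path_homotopy ?Sph F v (linepath ?e ?e)"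
    unfolding homotopic_paths_iff by blast
  note F = path_homotopyD[OF this]
  obtain B where B: "A \<simeq> B" "\<And>t. t \<in> {0..1} \<Longrightarrow> B t *v ?e = F 1 t"
    "\<And>w t. w \<in> (\<lambda>i. axis i 1) ` S \<Longrightarrow> t \<in> {0..1} \<Longrightarrow> B t *v w = w"
  proof (rule lift_homotopy[OF A F(1)])
    show "norm (F s t) = 1" if "s \<in> {0..1}" "t \<in> {0..1}" for s t
      using F(2)[OF that] by simp
    show "F s t \<bullet> w = 0" if "w \<in> (\<lambda>i. axis i 1) ` S" "s \<in> {0..1}" "t \<in> {0..1}" for w s t
      using F(2)[OF that(2,3)] that(1) by (auto simp: inner_axis)
  qed (use F(3,5,6) fix_S v_ends in \<open>auto simp: v_def\<close>)
  show thesis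
    by (rule that[OF B(1)]) (use B(2,3) F(4) in \<open>auto simp: linepath_refl\<close>)
qed

lemma loop_fix_all_but_two:
  fixes A :: "real \<Rightarrow> real^'n^'n"
  assumes A: "A \<in> loops SO_set (mat 1)" and "a \<noteq> b"
  obtains B where "A \<simeq> B" "\<And>i t. i \<noteq> a \<Longrightarrow> i \<noteq> b \<Longrightarrow> t \<in> {0..1} \<Longrightarrow> B t *v axis i 1 = axis i 1"
proof -
  have "finite S \<Longrightarrow> S \<subseteq> - {a, b} \<Longrightarrow> \<exists>B. A \<simeq> B \<and> (\<forall>i\<in>S. \<forall>t\<in>{0..1}. B t *v axis i 1 = axis i 1)" for S
  proof (induction S rule: finite_induct)
    case empty
    have "A \<simeq> A" using A by (simp add: loops_def)
    then show ?case by (intro exI[of _ A]) auto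
  next
    case (insert c S)
    then obtain B where B: "A \<simeq> B" "\<And>i t. i \<in> S \<Longrightarrow> t \<in> {0..1} \<Longrightarrow> B t *v axis i 1 = axis i 1"
      by auto
    obtain C where "B \<simeq> C" "\<And>i t. i \<in> insert c S \<Longrightarrow> t \<in> {0..1} \<Longrightarrow> C t *v axis i 1 = axis i 1"
      by (rule loop_fix_axis[OF loops_homotopic[OF A B(1)] B(2), of S a b c]) (use insert \<open>a \<noteq> b\<close> in auto)
    then show ?case using B(1) homotopic_paths_trans by blast
  qed
  from this[of "- {a, b}"] show thesis using that by auto
qed

section \<open>Every loop of rotations is null-homotopic or a full turn\<close>

text \<open>
  The orbit of the axis \<open>a\<close> is a loop on the unit circle of the plane of \<open>a\<close> and \<open>b\<close>, which has a
  continuous angle function. The rotation through this angle accounts for all of \<open>A\<close>: the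
  quotient fixes every axis except possibly \<open>b\<close>, and its determinant leaves no choice there.
\<close>
lemma loop_in_plane_is_rot:
  fixes A :: "real \<Rightarrow> real^'n^'n"
  assumes A: "A \<in> loops SO_set (mat 1)" and "a \<noteq> b"
    and fix_S: "\<And>i t. i \<noteq> a \<Longrightarrow> i \<noteq> b \<Longrightarrow> t \<in> {0..1} \<Longrightarrow> A t *v axis i 1 = axis i 1"
  obtains m where "A \<simeq> turns a b m"
proof -
  define v where "v = (\<lambda>t. A t *v axis a 1)"
  have SO_A: "A t \<in> SO_set" if "t \<in> {0..1}" for t
    using A that by (auto simp: loops_def path_image_def)
  have ends: "A 0 = mat 1" "A 1 = mat 1" using A by (auto simp: loops_def pathstart_def pathfinish_def)
  have contA: "continuous_on {0..1} A" using A by (simp add: loops_def path_def)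
  have v0: "v t $ i = 0" if "t \<in> {0..1}" "i \<noteq> a" "i \<noteq> b" for t i
  proof -
    have "v t $ i = v t \<bullet> axis i 1" by (simp add: inner_axis)
    also have "\<dots> = (A t *v axis a 1) \<bullet> (A t *v axis i 1)" using that fix_S by (simp add: v_def)
    also have "\<dots> = 0" using SO_A[OF that(1)] that by (auto simp: matrix_vector_inner_SO inner_axis_axis)
    finally show ?thesis .
  qed
  have v1: "(v t $ a)\<^sup>2 + (v t $ b)\<^sup>2 = 1" if "t \<in> {0..1}" for t
  proof -
    have "1 = v t \<bullet> v t" using SO_A[OF that] by (simp add: v_def matrix_vector_inner_SO inner_axis_axis)
    also have "\<dots> = (\<Sum>i\<in>UNIV. v t $ i * v t $ i)" by (simp add: inner_vec_def)
    also have "\<dots> = (\<Sum>i\<in>{a, b}. v t $ i * v t $ i)"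
      using v0[OF that] by (intro sum.mono_neutral_right) auto
    finally show ?thesis using \<open>a \<noteq> b\<close> by (simp add: power2_eq_square)
  qed
  define z where "z = (\<lambda>t. Complex (v t $ a) (v t $ b))"
  have "continuous_on {0..1} v" unfolding v_def by (intro continuous_intros contA)
  then have "continuous_on {0..1} z"
    unfolding z_def Complex_eq by (intro continuous_intros)
  moreover have "contractible {0..1::real}" by (simp add: convex_imp_contractible)
  moreover have norm_z: "norm (z t) = 1" if "t \<in> {0..1}" for t
    using v1[OF that] by (simp add: z_def cmod_def)
  ultimately obtain g where g: "continuous_on {0..1} g" "\<And>t. t \<in> {0..1} \<Longrightarrow> z t = exp (g t)"
    using continuous_logarithm_on_contractible[of "{0..1}" z] by (metis norm_zero zero_neq_one)
  have Re0: "Re (g t) = 0" if "t \<in> {0..1}" for t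
    using norm_z[OF that] g(2)[OF that] by simp
  have v_eq: "v t $ a = cos (Im (g t))" "v t $ b = sin (Im (g t))" if "t \<in> {0..1}" for t
    using g(2)[OF that] Re0[OF that] by (auto simp: z_def complex_eq_iff Re_exp Im_exp)
  have v_ends: "v 0 = axis a 1" "v 1 = axis a 1" using ends by (simp_all add: v_def)
  have sc0: "cos (Im (g 0)) = 1" "sin (Im (g 0)) = 0" "cos (Im (g 1)) = 1" "sin (Im (g 1)) = 0"
    using v_eq[of 0] v_eq[of 1] v_ends \<open>a \<noteq> b\<close> by (auto simp: axis_def)
  \<comment> \<open>A logarithm of \<open>z\<close> may start at any multiple of the full angle; the shift makes it start at \<open>0\<close>.\<close>
  define \<theta> where "\<theta> = (\<lambda>t. Im (g t) - Im (g 0))"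
  have v_\<theta>: "v t $ a = cos (\<theta> t)" "v t $ b = sin (\<theta> t)" if "t \<in> {0..1}" for t
    using v_eq[OF that] sc0 by (auto simp: \<theta>_def cos_diff sin_diff)
  have "cos (\<theta> 1) = 1" using sc0 by (simp add: \<theta>_def cos_diff)
  then obtain m :: int where m: "\<theta> 1 = 2 * pi * of_int m"
    by (auto simp: cos_one_2pi_int mult_ac)
  have rot_A: "A t = rot a b (\<theta> t)" if t: "t \<in> {0..1}" for t
  proof -
    define Q where "Q = rot a b (- \<theta> t) ** A t"
    have Q_SO: "Q \<in> SO_set" unfolding Q_def using \<open>a \<noteq> b\<close> SO_A[OF t] by (intro SO_mult) auto
    have Q_fix: "Q *v axis i 1 = axis i 1" if "i \<noteq> b" for i
    proof (cases "i = a")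
      case True
      have "v t = rot a b (\<theta> t) *v axis a 1"
        using \<open>a \<noteq> b\<close> v0[OF t] v_\<theta>[OF t] by (auto simp: vec_eq_iff rot_vec axis_def)
      moreover have "Q *v axis a 1 = rot a b (- \<theta> t) *v v t"
        by (simp add: Q_def v_def matrix_vector_mul_assoc)
      ultimately have "Q *v axis a 1 = (rot a b (- \<theta> t) ** rot a b (\<theta> t)) *v axis a 1"
        by (simp add: matrix_vector_mul_assoc)
      then show ?thesis using True \<open>a \<noteq> b\<close> by (simp add: rot_add)
    next
      case False
      then have "Q *v axis i 1 = rot a b (- \<theta> t) *v axis i 1"
        using fix_S[OF False that t] by (simp add: Q_def flip: matrix_vector_mul_assoc)
      then show ?thesis using False that \<open>a \<noteq> b\<close> by (auto simp: vec_eq_iff rot_vec axis_def)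
    qed
    have entry: "Q $ i $ j = (Q *v axis j 1) \<bullet> axis i 1" for i j
      by (simp add: inner_axis matrix_vector_mult_basis column_def)
    have off: "Q $ i $ j = (if i = j then 1 else 0)" if "i \<noteq> b \<or> j \<noteq> b" for i j
    proof (cases "j = b")
      case False
      then show ?thesis by (simp add: entry Q_fix inner_axis_axis)
    next
      case True
      then have "Q $ i $ j = (Q *v axis j 1) \<bullet> (Q *v axis i 1)"
        using that by (simp add: entry Q_fix)
      then show ?thesis using Q_SO by (auto simp: matrix_vector_inner_SO inner_axis_axis)
    qed
    have "1 = det Q" using Q_SO by (simp add: SO_set_iff)
    also have "\<dots> = (\<Prod>i\<in>UNIV. Q $ i $ i)" by (rule det_diagonal) (metis off)
    also have "\<dots> = (\<Prod>i\<in>{b}. Q $ i $ i)" by (rule prod.mono_neutral_right) (use off in auto)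
    finally have "Q $ b $ b = 1" by simp
    then have "Q $ i $ j = (if i = j then 1 else 0)" for i j
      using off[of i j] by (cases "i = b \<and> j = b") auto
    then have "Q = mat 1" by (simp add: vec_eq_iff mat_def)
    then have "rot a b (\<theta> t) ** Q = rot a b (\<theta> t)" by simp
    then show ?thesis using \<open>a \<noteq> b\<close> by (simp add: Q_def matrix_mul_assoc rot_add)
  qed
  have "A \<simeq> (\<lambda>t. rot a b (\<theta> t))"
    using A rot_A by (intro homotopic_paths_eq) (auto simp: loops_def)
  also have "\<dots> \<simeq> turns a b m"
    by (rule rot_angle_homotopic_turns) (use \<open>a \<noteq> b\<close> m g(1) in \<open>auto simp: \<theta>_def intro!: continuous_intros\<close>)
  finally show thesis by (rule that)
qed

text \<open>
  Deform the loop into one plane, read off the number of turns there, and reduce this number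
  modulo two.
\<close>
lemma loop_SO_cases:
  fixes A :: "real \<Rightarrow> real^'n^'n"
  assumes "CARD('n) \<ge> 3" "A \<in> loops SO_set (mat 1)" "a \<noteq> b"
  shows "A \<simeq> (\<lambda>_. mat 1) \<or> A \<simeq> turns a b 1"
proof -
  obtain c where c: "c \<noteq> a" "c \<noteq> b" by (rule obtain_third_index[OF assms(1)])
  obtain B where B: "A \<simeq> B" "\<And>i t. i \<noteq> a \<Longrightarrow> i \<noteq> b \<Longrightarrow> t \<in> {0..1} \<Longrightarrow> B t *v axis i 1 = axis i 1"
    using loop_fix_all_but_two[OF assms(2,3)] by metis
  obtain m where "B \<simeq> turns a b m"
    using loop_in_plane_is_rot[OF loops_homotopic[OF assms(2) B(1)] assms(3) B(2)] by metis
  then have "A \<simeq> turns a b m" using B(1) homotopic_paths_trans by blast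
  moreover have "turns a b m \<simeq> (\<lambda>_. mat 1) \<or> turns a b m \<simeq> turns a b 1"
    using turns_even[OF assms(3) c] turns_odd[OF assms(3) c] by (metis evenE oddE)
  ultimately show ?thesis using homotopic_paths_trans by blast
qed

text \<open>
  A null-homotopic \<open>\<beta>\<close> has a null-homotopic square, and the full turn squares to
  two turns, which a third axis makes null-homotopic.
\<close>
lemma loop_square_null:
  fixes \<beta> :: "real \<Rightarrow> real^'n^'n"
  assumes n: "CARD('n) \<ge> 3" and \<beta>: "\<beta> \<in> loops SO_set (mat 1)"
  shows "(\<lambda>t. \<beta> t ** \<beta> t) \<simeq> (\<lambda>_. mat 1)"
proof -
  fix a :: 'n
  obtain b where "b \<noteq> a" by (rule obtain_third_index[OF n, of a a])
  then have ab: "a \<noteq> b" by simp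
  obtain c where c: "c \<noteq> a" "c \<noteq> b" by (rule obtain_third_index[OF n])
  from loop_SO_cases[OF n \<beta> ab] show ?thesis
  proof
    assume "\<beta> \<simeq> (\<lambda>_. mat 1)"
    from path_homotopic_mult[OF this this] show ?thesis by simp
  next
    assume "\<beta> \<simeq> turns a b 1"
    from path_homotopic_mult[OF this this] have "(\<lambda>t. \<beta> t ** \<beta> t) \<simeq> turns a b (2 * 1)"
      using ab by (simp add: turns_add)
    then show ?thesis using turns_even[OF ab c] homotopic_paths_trans by blast
  qed
qed

lemma path_class_eqI: "homotopic_paths S p q \<Longrightarrow> path_class S p = path_class S q"
  unfolding path_class_def using homotopic_paths_sym homotopic_paths_trans by blast

lemma path_class_eqD:
  assumes "path_class S p = path_class S q" "q \<in> loops S a"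
  shows "homotopic_paths S p q"
proof -
  have "q \<in> path_class S q" using assms(2) by (auto simp: path_class_def loops_def)
  then show ?thesis using assms(1) by (auto simp: path_class_def)
qed

lemma fundamental_group_mult:
  assumes "p \<in> loops S a" "q \<in> loops S a"
  shows "path_class S p \<otimes>\<^bsub>fundamental_group S a\<^esub> path_class S q = path_class S (p +++ q)"
proof -
  have pq: "p \<in> path_class S p" "q \<in> path_class S q"
    using assms by (auto simp: path_class_def loops_def)
  have "(case y of (p', q') \<Rightarrow> path_class S (p' +++ q')) = (case (p, q) of (p', q') \<Rightarrow> path_class S (p' +++ q'))"
    if y_in: "y \<in> path_class S p \<times> path_class S q" for y
  proof -
    obtain p' q' where y: "y = (p', q')" "homotopic_paths S p p'" "homotopic_paths S q q'"
      using y_in by (auto simp: path_class_def)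
    then have "homotopic_paths S (p +++ q) (p' +++ q')"
      using assms by (intro homotopic_paths_join) (auto simp: loops_def)
    then show ?thesis using y path_class_eqI by auto
  qed
  from the_elem_image_unique[where f = "\<lambda>(p, q). path_class S (p +++ q)"
      and a = "path_class S (p +++ q)" and A = "path_class S p \<times> path_class S q"] this show ?thesis
    using pq by (auto simp: fundamental_group_def)
qed

text \<open>
  Inverses enter the generated set through a definite description over the carrier, so it has to be
  checked that the unit is its own inverse and the only one.
\<close>
lemma generate_one_fundamental_group:
  fixes S :: "'a::real_normed_vector set"
  assumes "a \<in> S"
  defines "G \<equiv> fundamental_group S a"
  shows "generate G {\<one>\<^bsub>G\<^esub>} \<subseteq> {\<one>\<^bsub>G\<^esub>}"
proof -
  have one: "\<one>\<^bsub>G\<^esub> = path_class S (linepath a a)"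
    by (simp add: G_def fundamental_group_def linepath_refl)
  have loop: "linepath a a \<in> loops S a"
    using assms by (simp add: loops_def)
  have one_carrier: "\<one>\<^bsub>G\<^esub> \<in> carrier G"
    using loop unfolding one by (simp add: G_def fundamental_group_def)
  have l_one: "\<one>\<^bsub>G\<^esub> \<otimes>\<^bsub>G\<^esub> x = x" if x_in: "x \<in> carrier G" for x
  proof -
    obtain p where p: "p \<in> loops S a" "x = path_class S p"
      using x_in by (auto simp: G_def fundamental_group_def)
    have "homotopic_paths S (linepath a a +++ p) p"
      using p(1) by (intro homotopic_paths_lid') (auto simp: loops_def)
    then show ?thesis
      unfolding one p(2) unfolding G_def fundamental_group_mult[OF loop p(1)] by (rule path_class_eqI)
  qed
  have inv_one: "inv\<^bsub>G\<^esub> \<one>\<^bsub>G\<^esub> = \<one>\<^bsub>G\<^esub>"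
    unfolding m_inv_def
    by (rule the_equality) (use one_carrier l_one in auto)
  have "h = \<one>\<^bsub>G\<^esub>" if "h \<in> generate G {\<one>\<^bsub>G\<^esub>}" for h
    using that by (induction rule: generate.induct) (auto simp: inv_one l_one one_carrier)
  then show ?thesis by blast
qed

text \<open>
  If the generator were null-homotopic, the fundamental group would be trivial and the full turn
  would be null-homotopic too, hence again homotopic to the generator.
\<close>
lemma generator_homotopic_turn:
  fixes \<eta> :: "real \<Rightarrow> real^'n^'n"
  assumes n: "CARD('n) \<ge> 3" and "a \<noteq> b" and \<eta>: "\<eta> \<in> loops SO_set (mat 1)"
    and gen: "generate (fundamental_group SO_set (mat 1)) {path_class SO_set \<eta>}
           = carrier (fundamental_group SO_set (mat 1 :: real^'n^'n))"
  shows "\<eta> \<simeq> turns a b 1"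
  using loop_SO_cases[OF n \<eta> \<open>a \<noteq> b\<close>]
proof
  let ?G = "fundamental_group SO_set (mat 1 :: real^'n^'n)"
  assume \<eta>1: "\<eta> \<simeq> (\<lambda>_. mat 1)"
  have one: "\<one>\<^bsub>?G\<^esub> = path_class SO_set (\<lambda>_. mat 1)" by (simp add: fundamental_group_def)
  then have "path_class SO_set \<eta> = \<one>\<^bsub>?G\<^esub>" using path_class_eqI[OF \<eta>1] by simp
  then have "carrier ?G \<subseteq> {\<one>\<^bsub>?G\<^esub>}"
    using gen generate_one_fundamental_group[of "mat 1" "SO_set :: (real^'n^'n) set"] by simp
  moreover have "path_class SO_set (turns a b 1) \<in> carrier ?G"
    using turns_loop[OF \<open>a \<noteq> b\<close>] by (simp add: fundamental_group_def)
  ultimately have "path_class SO_set (\<lambda>_. mat 1) = path_class SO_set (turns a b 1)"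
    unfolding one by auto
  then have "(\<lambda>_. mat 1) \<simeq> turns a b 1"
    using path_class_eqD turns_loop[OF \<open>a \<noteq> b\<close>] by blast
  then show ?thesis using \<eta>1 homotopic_paths_trans by blast
qed

section \<open>Squares of paths to minus the identity\<close>

text \<open>
  Consecutive entries of the list span the planes of rotation. The index type carries no order, so a
  list that enumerates it serves to pair up the coordinates; for such a list this is a circle subgroup
  acting as multiplication by \<open>exp(i \<theta>)\<close>.
\<close>
fun planes_rot :: "'n list \<Rightarrow> real \<Rightarrow> real^'n^'n" where
  "planes_rot (a # b # xs) \<theta> = rot a b \<theta> ** planes_rot xs \<theta>"
| "planes_rot _ \<theta> = mat 1"

lemma planes_rot_SO: "distinct xs \<Longrightarrow> planes_rot xs \<theta> \<in> SO_set"
  by (induction xs \<theta> rule: planes_rot.induct) (auto intro: SO_mult)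

lemma continuous_on_planes_rot [continuous_intros]:
  "continuous_on S f \<Longrightarrow> continuous_on S (\<lambda>x. planes_rot xs (f x))"
proof (induction xs "0::real" rule: planes_rot.induct)
  case (1 a b xs)
  then show ?case by (auto intro!: continuous_on_matrix_mult continuous_on_rot)
qed simp_all

lemma rot_commute:
  assumes "a \<noteq> b" "c \<noteq> d" "{a, b} \<inter> {c, d} = {}"
  shows "rot a b \<theta> ** rot c d \<phi> = rot c d \<phi> ** rot a b \<theta>"
  using assms by (auto simp: matrix_eq vec_eq_iff rot_vec simp flip: matrix_vector_mul_assoc)

lemma rot_commute_planes_rot:
  assumes "a \<noteq> b" "{a, b} \<inter> set xs = {}" "distinct xs"
  shows "rot a b \<theta> ** planes_rot xs \<phi> = planes_rot xs \<phi> ** rot a b \<theta>"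
  using assms(2,3)
proof (induction xs \<phi> rule: planes_rot.induct)
  case (1 c d xs \<phi>)
  have "rot a b \<theta> ** planes_rot (c # d # xs) \<phi> = (rot a b \<theta> ** rot c d \<phi>) ** planes_rot xs \<phi>"
    by (simp add: matrix_mul_assoc)
  also have "\<dots> = rot c d \<phi> ** (rot a b \<theta> ** planes_rot xs \<phi>)"
    using 1(2,3) assms(1) by (subst rot_commute) (auto simp: matrix_mul_assoc)
  also have "\<dots> = rot c d \<phi> ** (planes_rot xs \<phi> ** rot a b \<theta>)"
    using 1 by simp
  finally show ?case by (simp add: matrix_mul_assoc)
qed simp_all

lemma planes_rot_add:
  "distinct xs \<Longrightarrow> planes_rot xs \<theta> ** planes_rot xs \<phi> = planes_rot xs (\<theta> + \<phi>)"
proof (induction xs \<theta> rule: planes_rot.induct)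
  case (1 a b xs \<theta>)
  then have ab: "a \<noteq> b" "{a, b} \<inter> set xs = {}" "distinct xs" by auto
  have "planes_rot (a # b # xs) \<theta> ** planes_rot (a # b # xs) \<phi>
      = rot a b \<theta> ** (planes_rot xs \<theta> ** rot a b \<phi>) ** planes_rot xs \<phi>"
    by (simp add: matrix_mul_assoc)
  also have "\<dots> = (rot a b \<theta> ** rot a b \<phi>) ** (planes_rot xs \<theta> ** planes_rot xs \<phi>)"
    unfolding rot_commute_planes_rot[OF ab, symmetric] by (simp add: matrix_mul_assoc)
  finally show ?case using 1 ab by (simp add: rot_add)
qed simp_all

lemma planes_rot_0: "distinct xs \<Longrightarrow> planes_rot xs 0 = mat 1"
  by (induction xs "0::real" rule: planes_rot.induct) auto

lemma planes_rot_pi_vec: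
  "distinct xs \<Longrightarrow> even (length xs) \<Longrightarrow>
     (planes_rot xs pi *v x) $ i = (if i \<in> set xs then - x $ i else x $ i)"
proof (induction xs pi rule: planes_rot.induct)
  case (1 a b xs)
  then show ?case by (auto simp: rot_vec simp flip: matrix_vector_mul_assoc)
qed simp_all

lemma planes_rot_homotopic_turns:
  fixes a b :: "'n::finite"
  assumes n: "CARD('n) \<ge> 3" and "a \<noteq> b"
  shows "distinct xs \<Longrightarrow> length xs = 2 * k \<Longrightarrow>
     (\<lambda>t. planes_rot xs (2 * pi * t)) \<simeq> turns a b (int k)"
proof (induction xs "0::real" arbitrary: k rule: planes_rot.induct)
  case (1 c d xs)
  then obtain j where j: "k = Suc j" by (cases k) auto
  have "(\<lambda>t. turns c d 1 t ** planes_rot xs (2 * pi * t)) \<simeq> (\<lambda>t. turns a b 1 t ** turns a b (int j) t)"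
    using 1 j \<open>a \<noteq> b\<close> by (intro path_homotopic_mult turns_any_plane[OF n]) auto
  moreover have "(\<lambda>t. turns c d 1 t ** planes_rot xs (2 * pi * t)) = (\<lambda>t. planes_rot (c # d # xs) (2 * pi * t))"
    by (simp add: turns_def)
  moreover have "(\<lambda>t. turns a b 1 t ** turns a b (int j) t) = turns a b (int k)"
    using \<open>a \<noteq> b\<close> by (simp add: turns_add j)
  ultimately show ?case by simp
qed (use \<open>a \<noteq> b\<close> in \<open>auto simp: turns_0 path_def path_image_def\<close>)

text \<open>
  With \<open>P\<close> the standard path and \<open>\<gamma> = P \<beta>\<close>, the loop \<open>\<beta>\<close> is homotopic to \<open>P \<beta> P\<^sup>-\<^sup>1\<close> by conjugation
  with \<open>P(s t)\<close>. Substituting this for the first \<open>\<beta>\<close> in \<open>P \<beta> P \<beta>\<close> gives \<open>P\<^sup>2 \<beta>\<^sup>2\<close>, and squares of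
  loops are null-homotopic.
\<close>
lemma square_path_to_minus_one:
  fixes \<gamma> :: "real \<Rightarrow> real^'n^'n"
  assumes n: "CARD('n) = 2 * k" "k > 1" and "a \<noteq> b"
    and \<gamma>: "path \<gamma>" "path_image \<gamma> \<subseteq> SO_set" "pathstart \<gamma> = mat 1" "pathfinish \<gamma> = - mat 1"
  shows "(\<lambda>t. \<gamma> t ** \<gamma> t) \<simeq> turns a b (int k)"
proof -
  have n3: "CARD('n) \<ge> 3" using n by simp
  obtain xs :: "'n list" where xs: "set xs = UNIV" "distinct xs"
    using finite_distinct_list[of "UNIV :: 'n set"] by auto
  then have len: "length xs = 2 * k" using n distinct_card[of xs] by simp
  define P where "P = (\<lambda>t. planes_rot xs (pi * t))"
  have P_SO: "P t \<in> SO_set" for t unfolding P_def by (rule planes_rot_SO[OF xs(2)])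
  have contP: "continuous_on S P" for S
    unfolding P_def by (intro continuous_intros)
  have P0: "P 0 = mat 1" using planes_rot_0[OF xs(2)] by (simp add: P_def)
  have P1: "P 1 = - mat 1"
  proof -
    have "P 1 *v x = - mat 1 *v x" for x
      using planes_rot_pi_vec[OF xs(2), of x] len xs(1)
      by (simp add: P_def vec_eq_iff matrix_vector_mult_minus_left)
    then show ?thesis by (simp add: matrix_eq)
  qed
  define \<beta> where "\<beta> = (\<lambda>t. transpose (P t) ** \<gamma> t)"
  have \<gamma>_eq: "\<gamma> t = P t ** \<beta> t" for t
    by (simp add: \<beta>_def matrix_mul_assoc SO_inverse[OF P_SO])
  have \<beta>: "\<beta> \<in> loops SO_set (mat 1)"
  proof -
    have "continuous_on {0..1} \<beta>" unfolding \<beta>_def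
      using \<gamma>(1) by (intro continuous_intros contP) (simp add: path_def)
    moreover have "\<beta> t \<in> SO_set" if "t \<in> {0..1}" for t
      unfolding \<beta>_def using \<gamma>(2) that by (intro SO_mult SO_transpose P_SO) (auto simp: path_image_def)
    moreover have "\<beta> 0 = mat 1" using \<gamma>(3) P0 by (simp add: \<beta>_def pathstart_def)
    moreover have "\<beta> 1 = mat 1" using \<gamma>(4) P1 SO_inverse(1)[OF P_SO[of 1]] by (simp add: \<beta>_def pathfinish_def)
    ultimately show ?thesis
      by (auto simp: loops_def path_def path_image_def pathstart_def pathfinish_def)
  qed
  have conj: "\<beta> \<simeq> (\<lambda>t. P t ** \<beta> t ** transpose (P t))"
  proof -
    have "continuous_on ({0..1} \<times> {0..1}) (\<lambda>z::real\<times>real. P (fst z * snd z))"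
      unfolding P_def by (intro continuous_intros)
    from loop_path_homotopic_conj_family[OF \<beta>, of "\<lambda>s t. P (s * t)", OF this] show ?thesis
      by (simp add: P_SO P0)
  qed
  have pathP: "P \<simeq> P" by (auto simp: path_def contP path_image_def P_SO)
  have "\<beta> \<simeq> \<beta>" using \<beta> by (simp add: loops_def)
  have "(\<lambda>t. \<gamma> t ** \<gamma> t) = (\<lambda>t. (P t ** \<beta> t) ** (P t ** \<beta> t))" by (simp add: \<gamma>_eq)
  moreover have "(\<lambda>t. (P t ** \<beta> t) ** (P t ** \<beta> t)) \<simeq>
      (\<lambda>t. (P t ** (P t ** \<beta> t ** transpose (P t))) ** (P t ** \<beta> t))"
    by (intro path_homotopic_mult conj pathP \<open>\<beta> \<simeq> \<beta>\<close>)
  moreover have "(\<lambda>t. (P t ** (P t ** \<beta> t ** transpose (P t))) ** (P t ** \<beta> t))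
      = (\<lambda>t. (P t ** P t) ** (\<beta> t ** \<beta> t))"
  proof
    fix t
    have "(P t ** (P t ** \<beta> t ** transpose (P t))) ** (P t ** \<beta> t)
        = P t ** P t ** \<beta> t ** (transpose (P t) ** P t) ** \<beta> t"
      by (simp add: matrix_mul_assoc)
    also have "\<dots> = (P t ** P t) ** (\<beta> t ** \<beta> t)"
      by (simp add: SO_inverse[OF P_SO] matrix_mul_assoc)
    finally show "(P t ** (P t ** \<beta> t ** transpose (P t))) ** (P t ** \<beta> t) = (P t ** P t) ** (\<beta> t ** \<beta> t)" .
  qed
  moreover have "(\<lambda>t. (P t ** P t) ** (\<beta> t ** \<beta> t)) \<simeq> (\<lambda>t. (P t ** P t) ** mat 1)"
    by (rule path_homotopic_mult[OF path_homotopic_mult[OF pathP pathP] loop_square_null[OF n3 \<beta>]])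
  moreover have "(\<lambda>t. (P t ** P t) ** mat 1) = (\<lambda>t. planes_rot xs (2 * pi * t))"
    by (simp add: P_def planes_rot_add[OF xs(2)] algebra_simps)
  moreover have "(\<lambda>t. planes_rot xs (2 * pi * t)) \<simeq> turns a b (int k)"
    by (rule planes_rot_homotopic_turns[OF n3 \<open>a \<noteq> b\<close> xs(2) len])
  ultimately show ?thesis
    by (metis (no_types, lifting) homotopic_paths_trans)
qed

section \<open>Conjugating central paths over the suspension\<close>

text \<open>The suspension is an abstract topology, so continuity of products is also needed in that form.\<close>
lemma continuous_map_matrix_mult:
  fixes f g :: "'a \<Rightarrow> real^'n^'n"
  assumes "continuous_map X euclidean f" "continuous_map X euclidean g"
  shows "continuous_map X euclidean (\<lambda>x. f x ** g x)"
proof -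
  have "continuous_on UNIV (\<lambda>z::(real^'n^'n) \<times> (real^'n^'n). fst z ** snd z)"
    by (intro continuous_intros)
  then have "continuous_map (prod_topology euclidean euclidean) euclidean
      (\<lambda>z::(real^'n^'n) \<times> (real^'n^'n). fst z ** snd z)"
    by (simp add: euclidean_product_topology)
  from continuous_map_compose[OF continuous_map_pairedI[OF assms] this] show ?thesis
    by (simp add: o_def)
qed

lemma continuous_map_transpose:
  fixes f :: "'a \<Rightarrow> real^'n^'n"
  assumes "continuous_map X euclidean f"
  shows "continuous_map X euclidean (\<lambda>x. transpose (f x))"
proof -
  have "continuous_map euclidean euclidean (transpose :: real^'n^'n \<Rightarrow> _)"
    by (simp add: continuous_on_transpose)
  from continuous_map_compose[OF assms this] show ?thesis by (simp add: o_def)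
qed

lemma continuous_map_SO_mult:
  fixes f g :: "'a \<Rightarrow> real^'n^'n"
  assumes "continuous_map X SO f" "continuous_map X SO g"
  shows "continuous_map X SO (\<lambda>x. f x ** g x)"
  using assms by (auto simp: continuous_map_in_subtopology intro!: continuous_map_matrix_mult SO_mult)

lemma continuous_map_SO_transpose:
  fixes f :: "'a \<Rightarrow> real^'n^'n"
  assumes "continuous_map X SO f"
  shows "continuous_map X SO (\<lambda>x. transpose (f x))"
  using assms by (auto simp: continuous_map_in_subtopology intro!: continuous_map_transpose SO_transpose)

lemma homotopic_SO_mult:
  assumes "homotopic_with (\<lambda>_. True) X SO f f'" "homotopic_with (\<lambda>_. True) X SO h h'"
  shows "homotopic_with (\<lambda>_. True) X SO (\<lambda>x. f x ** h x) (\<lambda>x. f' x ** h' x)"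
proof -
  obtain H K where "continuous_map (prod_topology (top_of_set {0..1::real}) X) SO H"
      "\<forall>x. H (0, x) = f x" "\<forall>x. H (1, x) = f' x"
      "continuous_map (prod_topology (top_of_set {0..1::real}) X) SO K"
      "\<forall>x. K (0, x) = h x" "\<forall>x. K (1, x) = h' x"
    using assms unfolding homotopic_with_def by auto
  then show ?thesis
    unfolding homotopic_with_def
    by (intro exI[of _ "\<lambda>z. H z ** K z"]) (auto intro: continuous_map_SO_mult)
qed

lemma homotopy_class_eqI:
  "homotopic_with (\<lambda>_. True) X Y f h \<Longrightarrow> homotopy_class X Y f = homotopy_class X Y h"
  unfolding homotopy_class_def using homotopic_with_symD homotopic_with_trans by blast

lemma homotopy_class_self: "continuous_map X Y f \<Longrightarrow> f \<in> homotopy_class X Y f"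
  by (simp add: homotopy_class_def)

lemma SO_classes_mult:
  assumes "continuous_map Y SO f" "continuous_map Y SO h"
  shows "homotopy_class Y SO f \<otimes>\<^bsub>SO_classes Y\<^esub> homotopy_class Y SO h
    = homotopy_class Y SO (\<lambda>y. f y ** h y)"
proof -
  let ?m = "\<lambda>(f, h). homotopy_class Y SO (\<lambda>y. f y ** h y)"
  have "?m z = ?m (f, h)" if "z \<in> homotopy_class Y SO f \<times> homotopy_class Y SO h" for z
    using that by (auto simp: homotopy_class_def[of _ _ f] homotopy_class_def[of _ _ h]
        intro!: homotopy_class_eqI[symmetric] homotopic_SO_mult)
  then have "the_elem (?m ` (homotopy_class Y SO f \<times> homotopy_class Y SO h)) = ?m (f, h)"
    using assms[THEN homotopy_class_self] by (intro the_elem_image_unique) auto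
  then show ?thesis by (simp add: SO_classes_def)
qed

text \<open>Endpoints in the centre make conjugation constant on each of the two ends that the suspension collapses.\<close>
definition central_path :: "(real \<Rightarrow> real^'n^'n) \<Rightarrow> bool" where
  "central_path \<delta> \<longleftrightarrow> path \<delta> \<and> path_image \<delta> \<subseteq> SO_set \<and>
     pathstart \<delta> \<in> {mat 1, - mat 1} \<and> pathfinish \<delta> \<in> {mat 1, - mat 1}"

lemma TO_map_susp_point:
  fixes \<delta> :: "real \<Rightarrow> real^'n^'n"
  assumes \<delta>: "\<delta> 0 \<in> {mat 1, - mat 1}" "\<delta> 1 \<in> {mat 1, - mat 1}"
    and g: "\<And>x. x \<in> topspace X \<Longrightarrow> g x \<in> SO_set"
    and x: "x \<in> topspace X" "t \<in> {0..1}"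
  shows "TO_map \<delta> g (susp_point X x t) = g x ** \<delta> t ** transpose (g x)"
proof -
  have central: "A ** \<delta> s ** transpose A = \<delta> s" if "s = 0 \<or> s = 1" "A \<in> SO_set" for s A
  proof -
    have "\<delta> s = mat 1 \<or> \<delta> s = - mat 1" using that(1) \<delta> by auto
    moreover have "A ** - mat 1 ** transpose A = - mat 1"
      using that(2) by (simp add: matrix_mult_minus_left matrix_mult_minus_right)
    ultimately show ?thesis using that(2) by auto
  qed
  have "(case z of (y, s) \<Rightarrow> g y ** \<delta> s ** matrix_inv (g y))
      = (case (x, t) of (y, s) \<Rightarrow> g y ** \<delta> s ** matrix_inv (g y))"
    if z_in: "z \<in> susp_point X x t" for z
  proof -
    obtain y where y: "z = (y, t)" "y \<in> topspace X" "y = x \<or> t = 0 \<or> t = 1"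
      using z_in by (auto simp: susp_point_def)
    then show ?thesis using central[of t "g y"] central[of t "g x"] g x by (auto simp: matrix_inv_SO)
  qed
  then have "TO_map \<delta> g (susp_point X x t) = (case (x, t) of (y, s) \<Rightarrow> g y ** \<delta> s ** matrix_inv (g y))"
    unfolding TO_map_def using x by (intro the_elem_image_unique) (auto simp: susp_point_def)
  then show ?thesis using x g by (simp add: matrix_inv_SO)
qed

lemma topspace_suspensionE:
  assumes "z \<in> topspace (suspension X)"
  obtains x t where "x \<in> topspace X" "t \<in> {0..1}" "z = susp_point X x t"
  using assms by (auto simp: suspension_def topspace_quotient_topology)

text \<open>
  A homotopy of the path and one of the clutching function combine to a homotopy of the conjugation
  maps over \<open>X \<times> [0,1]\<close>, whose stages are constant on the two collapsed ends because a homotopy of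
  paths does not move the endpoints. It descends to the suspension because the product of a quotient
  map with the compact interval is again a quotient map.
\<close>
lemma TO_map_homotopic:
  fixes \<delta> \<epsilon> :: "real \<Rightarrow> real^'n^'n" and X :: "'a topology"
  assumes \<delta>: "central_path \<delta>" and \<delta>\<epsilon>: "\<delta> \<simeq> \<epsilon>"
    and gh: "homotopic_with (\<lambda>_. True) X SO g h"
  shows "homotopic_with (\<lambda>_. True) (suspension X) SO (TO_map \<delta> g) (TO_map \<epsilon> h)"
proof -
  let ?I = "top_of_set {0..1::real}"
  obtain D where "path_homotopy SO_set D \<delta> \<epsilon>" using \<delta>\<epsilon> by (auto simp: homotopic_paths_iff)
  note D = path_homotopyD[OF this]
  obtain H where H: "continuous_map (prod_topology ?I X) SO H"
    "\<And>x. H (0, x) = g x" "\<And>x. H (1, x) = h x"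
    using gh unfolding homotopic_with_def by auto
  have H_SO: "H (s, x) \<in> SO_set" if "s \<in> {0..1}" "x \<in> topspace X" for s x
    using H(1) that by (force simp: continuous_map_in_subtopology)
  define K where "K = (\<lambda>(s, z). TO_map (D s) (\<lambda>x. H (s, x)) z)"
  have K: "K (s, susp_point X x t) = H (s, x) ** D s t ** transpose (H (s, x))"
    if "s \<in> {0..1}" "t \<in> {0..1}" "x \<in> topspace X" for s t x
    unfolding K_def prod.case
    by (rule TO_map_susp_point)
      (use that H_SO \<delta> D(5)[of s] D(6)[of s] in \<open>auto simp: central_path_def pathstart_def pathfinish_def\<close>)
  let ?q = "\<lambda>(x, t). susp_point X x t"
  let ?Q = "\<lambda>(s :: real, y). (s, ?q y)"
  have quot: "quotient_map (prod_topology ?I (prod_topology X ?I)) (prod_topology ?I (suspension X)) ?Q"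
    unfolding suspension_def
    by (rule quotient_map_prod_right)
      (auto simp: quotient_map_quotient_topology Hausdorff_space_subtopology
        compact_space_subtopology
        intro!: compact_imp_locally_compact_space)
  have contD: "continuous_map (prod_topology ?I (prod_topology X ?I)) SO (\<lambda>w. D (fst w) (snd (snd w)))"
  proof -
    have 1: "continuous_map (prod_topology ?I ?I) SO (\<lambda>z. D (fst z) (snd z))"
      using D(1,2) by (auto simp: prod_topology_subtopology_eu)
    have 2: "continuous_map (prod_topology ?I (prod_topology X ?I)) (prod_topology ?I ?I) (\<lambda>w. (fst w, snd (snd w)))"
      by (intro continuous_map_pairedI continuous_map_fst
        continuous_map_compose[OF continuous_map_snd continuous_map_snd, unfolded o_def])
    from continuous_map_compose[OF 2 1] show ?thesis by (simp add: o_def)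
  qed
  have contH: "continuous_map (prod_topology ?I (prod_topology X ?I)) SO (\<lambda>w. H (fst w, fst (snd w)))"
  proof -
    have "continuous_map (prod_topology ?I (prod_topology X ?I)) (prod_topology ?I X) (\<lambda>w. (fst w, fst (snd w)))"
      by (intro continuous_map_pairedI continuous_map_fst
        continuous_map_compose[OF continuous_map_snd continuous_map_fst, unfolded o_def])
    from continuous_map_compose[OF this H(1)] show ?thesis by (simp add: o_def)
  qed
  have "continuous_map (prod_topology ?I (prod_topology X ?I)) SO
      (\<lambda>w. H (fst w, fst (snd w)) ** D (fst w) (snd (snd w)) ** transpose (H (fst w, fst (snd w))))"
    by (intro continuous_map_SO_mult continuous_map_SO_transpose contD contH)
  then have "continuous_map (prod_topology ?I (prod_topology X ?I)) SO (K \<circ> ?Q)"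
    by (rule continuous_map_eq) (auto simp: K)
  then have "continuous_map (prod_topology ?I (suspension X)) SO K"
    by (rule continuous_compose_quotient_map[OF quot])
  moreover have "K (0, z) = TO_map \<delta> g z" "K (1, z) = TO_map \<epsilon> h z" if z_in: "z \<in> topspace (suspension X)" for z
  proof -
    obtain x t where z: "x \<in> topspace X" "t \<in> {0..1}" "z = susp_point X x t"
      using z_in by (rule topspace_suspensionE)
    have ends: "\<delta> 0 \<in> {mat 1, - mat 1}" "\<delta> 1 \<in> {mat 1, - mat 1}"
      using \<delta> by (auto simp: central_path_def pathstart_def pathfinish_def)
    moreover have "\<epsilon> 0 = \<delta> 0" "\<epsilon> 1 = \<delta> 1"
      using D(4)[of 0] D(4)[of 1] D(5)[of 1] D(6)[of 1] by auto
    ultimately have ends': "\<epsilon> 0 \<in> {mat 1, - mat 1}" "\<epsilon> 1 \<in> {mat 1, - mat 1}" by auto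
    have "g y \<in> SO_set" "h y \<in> SO_set" if "y \<in> topspace X" for y
      using H_SO[of 0 y] H_SO[of 1 y] H(2,3) that by auto
    then show "K (0, z) = TO_map \<delta> g z" "K (1, z) = TO_map \<epsilon> h z"
      using z ends ends' by (simp_all add: K TO_map_susp_point D(3,4) H(2,3))
  qed
  ultimately show ?thesis
    by (subst homotopic_with) auto
qed

lemma continuous_TO_map:
  "central_path \<delta> \<Longrightarrow> continuous_map X SO g \<Longrightarrow> continuous_map (suspension X) SO (TO_map \<delta> g)"
  using TO_map_homotopic[of \<delta> \<delta> X g g] homotopic_with_imp_continuous_maps
  by (auto simp: central_path_def)

lemma TO_class:
  assumes "central_path \<delta>" "continuous_map X SO g"
  shows "TO X \<delta> (homotopy_class X SO g) = homotopy_class (suspension X) SO (TO_map \<delta> g)"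
proof -
  have const: "homotopy_class (suspension X) SO (TO_map \<delta> h) = homotopy_class (suspension X) SO (TO_map \<delta> g)"
    if "h \<in> homotopy_class X SO g" for h
    using that assms(1) by (intro homotopy_class_eqI[symmetric] TO_map_homotopic)
      (auto simp: homotopy_class_def central_path_def)
  have "homotopy_class X SO g \<noteq> {}" using homotopy_class_self[OF assms(2)] by blast
  then have "the_elem ((\<lambda>h. homotopy_class (suspension X) SO (TO_map \<delta> h)) ` homotopy_class X SO g)
      = homotopy_class (suspension X) SO (TO_map \<delta> g)"
    by (rule the_elem_image_unique) (rule const)
  then show ?thesis by (simp add: TO_def)
qed

lemma TO_cong:
  assumes "central_path \<delta>" "\<delta> \<simeq> \<epsilon>" "continuous_map X SO g"
  shows "TO X \<delta> (homotopy_class X SO g) = TO X \<epsilon> (homotopy_class X SO g)"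
proof -
  have "central_path \<epsilon>"
    using assms homotopic_paths_imp_path homotopic_paths_imp_subset homotopic_paths_imp_pathstart
      homotopic_paths_imp_pathfinish unfolding central_path_def by metis
  then show ?thesis
    using assms by (simp add: TO_class) (intro homotopy_class_eqI TO_map_homotopic, auto)
qed

lemma central_path_mult:
  assumes "central_path \<delta>" "central_path \<epsilon>"
  shows "central_path (\<lambda>t. \<delta> t ** \<epsilon> t)"
proof -
  have "- mat 1 ** - mat 1 = (mat 1 :: real^'n^'n)"
    by (simp add: matrix_mult_minus_left matrix_mult_minus_right)
  then show ?thesis
    using assms unfolding central_path_def
    by (auto simp: path_mult path_image_mult pathstart_def pathfinish_def)
qed

text \<open>
  Conjugation by \<open>g x\<close> is an automorphism, so the two conjugation maps multiply pointwise to the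
  conjugation map of the product path.
\<close>
lemma TO_mult:
  fixes \<delta> \<epsilon> :: "real \<Rightarrow> real^'n^'n"
  assumes \<delta>: "central_path \<delta>" and \<epsilon>: "central_path \<epsilon>" and g: "continuous_map X SO g"
  defines "c \<equiv> homotopy_class X SO g"
  shows "TO X \<delta> c \<otimes>\<^bsub>SO_classes (suspension X)\<^esub> TO X \<epsilon> c = TO X (\<lambda>t. \<delta> t ** \<epsilon> t) c"
proof -
  have \<delta>\<epsilon>: "central_path (\<lambda>t. \<delta> t ** \<epsilon> t)" by (rule central_path_mult[OF \<delta> \<epsilon>])
  have "TO_map \<delta> g z ** TO_map \<epsilon> g z = TO_map (\<lambda>t. \<delta> t ** \<epsilon> t) g z" if z_in: "z \<in> topspace (suspension X)" for z
  proof -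
    obtain x t where z: "x \<in> topspace X" "t \<in> {0..1}" "z = susp_point X x t"
      using z_in by (rule topspace_suspensionE)
    have gS: "g y \<in> SO_set" if "y \<in> topspace X" for y
      using g that by (force simp: continuous_map_in_subtopology)
    have "TO_map \<delta> g z ** TO_map \<epsilon> g z
        = (g x ** \<delta> t ** transpose (g x)) ** (g x ** \<epsilon> t ** transpose (g x))"
      using z gS \<delta> \<epsilon> by (simp add: TO_map_susp_point central_path_def pathstart_def pathfinish_def)
    also have "\<dots> = g x ** \<delta> t ** (transpose (g x) ** g x) ** \<epsilon> t ** transpose (g x)"
      by (simp add: matrix_mul_assoc)
    also have "\<dots> = g x ** (\<delta> t ** \<epsilon> t) ** transpose (g x)"
      using gS z by (simp add: matrix_mul_assoc)
    also have "\<dots> = TO_map (\<lambda>t. \<delta> t ** \<epsilon> t) g z"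
      using z gS \<delta>\<epsilon> by (simp add: TO_map_susp_point central_path_def pathstart_def pathfinish_def)
    finally show ?thesis .
  qed
  then have "homotopic_with (\<lambda>_. True) (suspension X) SO (\<lambda>z. TO_map \<delta> g z ** TO_map \<epsilon> g z)
      (TO_map (\<lambda>t. \<delta> t ** \<epsilon> t) g)"
    by (intro homotopic_with_equal continuous_map_SO_mult continuous_TO_map \<delta> \<epsilon> g) auto
  then show ?thesis
    using \<delta> \<epsilon> \<delta>\<epsilon> g by (simp add: c_def TO_class SO_classes_mult continuous_TO_map homotopy_class_eqI)
qed

lemma central_path_one: "central_path (\<lambda>_. mat 1)"
  by (auto simp: central_path_def path_def path_image_def pathstart_def pathfinish_def)

lemma TO_one:
  fixes X :: "'a topology" and g :: "'a \<Rightarrow> real^'n^'n"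
  assumes g: "continuous_map X SO g"
  shows "TO X (\<lambda>_. mat 1) (homotopy_class X SO g) = \<one>\<^bsub>SO_classes (suspension X)\<^esub>"
proof -
  have "TO_map (\<lambda>_. mat 1) g z = mat 1" if z_in: "z \<in> topspace (suspension X)" for z
  proof -
    obtain x t where z: "x \<in> topspace X" "t \<in> {0..1}" "z = susp_point X x t"
      using z_in by (rule topspace_suspensionE)
    have "g y \<in> SO_set" if "y \<in> topspace X" for y
      using g that by (force simp: continuous_map_in_subtopology)
    then show ?thesis using z by (simp add: TO_map_susp_point)
  qed
  then have "homotopic_with (\<lambda>_. True) (suspension X) SO (TO_map (\<lambda>_. mat 1) g) (\<lambda>_. mat 1)"
    by (intro homotopic_with_equal continuous_TO_map central_path_one g) auto
  then show ?thesis
    by (simp add: TO_class[OF central_path_one g] SO_classes_def homotopy_class_eqI)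
qed

lemma TO_power2:
  fixes \<delta> :: "real \<Rightarrow> real^'n^'n"
  assumes \<delta>: "central_path \<delta>" and g: "continuous_map X SO g"
  defines "c \<equiv> homotopy_class X SO g"
  shows "TO X \<delta> c [^]\<^bsub>SO_classes (suspension X)\<^esub> (2::nat) = TO X (\<lambda>t. \<delta> t ** \<delta> t) c"
  using TO_mult[OF central_path_one \<delta> g] TO_mult[OF \<delta> \<delta> g]
  by (simp add: numeral_2_eq_2 c_def TO_one[OF g])

lemma TO_power4:
  fixes \<delta> :: "real \<Rightarrow> real^'n^'n"
  assumes \<delta>: "central_path \<delta>" and g: "continuous_map X SO g"
  defines "c \<equiv> homotopy_class X SO g" and "\<epsilon> \<equiv> (\<lambda>t. \<delta> t ** \<delta> t)"
  shows "TO X \<delta> c [^]\<^bsub>SO_classes (suspension X)\<^esub> (4::nat) = TO X (\<lambda>t. \<epsilon> t ** \<epsilon> t) c"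
proof -
  let ?G = "SO_classes (suspension X) :: (('a \<times> real) set \<Rightarrow> real^'n^'n) set monoid"
  have \<epsilon>: "central_path \<epsilon>" unfolding \<epsilon>_def by (rule central_path_mult[OF \<delta> \<delta>])
  have "TO X \<delta> c [^]\<^bsub>?G\<^esub> (4::nat) = (TO X \<delta> c [^]\<^bsub>?G\<^esub> (2::nat) \<otimes>\<^bsub>?G\<^esub> TO X \<delta> c) \<otimes>\<^bsub>?G\<^esub> TO X \<delta> c"
    by (simp add: numeral_eq_Suc)
  also have "\<dots> = TO X (\<lambda>t. (\<epsilon> t ** \<delta> t) ** \<delta> t) c"
    using TO_power2[OF \<delta> g] TO_mult[OF \<epsilon> \<delta> g] TO_mult[OF central_path_mult[OF \<epsilon> \<delta>] \<delta> g]
    by (simp add: c_def \<epsilon>_def)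
  also have "\<dots> = TO X (\<lambda>t. \<epsilon> t ** \<epsilon> t) c"
    by (simp add: \<epsilon>_def matrix_mul_assoc)
  finally show ?thesis .
qed

section \<open>The torsion relations\<close>

theorem theorem1p7:
  fixes k :: nat
    and \<gamma> \<eta> :: "real \<Rightarrow> real^'n^'n"
    and X :: "'a topology"
    and E :: "'e topology"
    and p :: "'e \<Rightarrow> ('a \<times> real) set"
    and A :: "(('a \<times> real) set set \<times> (('a \<times> real) set \<times> (real^'n) \<Rightarrow> 'e)) set"
    and g :: "'a \<Rightarrow> real^'n^'n"
  assumes "k > 1" and "CARD('n) = 2 * k"
    and "path \<gamma>" and "path_image \<gamma> \<subseteq> SO_set"
    and "pathstart \<gamma> = mat 1" and "pathfinish \<gamma> = - mat 1"
    and "\<eta> \<in> loops SO_set (mat 1)"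
    and "generate (fundamental_group SO_set (mat 1)) {path_class SO_set \<eta>}
           = carrier (fundamental_group SO_set (mat 1 :: real^'n^'n))"
    and "CW_complex X"
    and "oriented_vector_bundle (suspension X) E p A"
    and "has_clutching_function X E p A g"
  shows "let G = (SO_classes (suspension X) :: (('a \<times> real) set \<Rightarrow> real^'n^'n) set monoid);
             c = homotopy_class X SO g
         in TO X \<eta> c [^]\<^bsub>G\<^esub> (2::nat) = \<one>\<^bsub>G\<^esub> \<and>
            TO X (\<eta> +++ \<gamma>) c = TO X \<eta> c \<otimes>\<^bsub>G\<^esub> TO X \<gamma> c \<and>
            (even k \<longrightarrow> TO X \<gamma> c [^]\<^bsub>G\<^esub> (2::nat) = \<one>\<^bsub>G\<^esub>) \<and>
            (odd k \<longrightarrow> TO X \<gamma> c [^]\<^bsub>G\<^esub> (2::nat) = TO X \<eta> c \<and>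
                       TO X \<gamma> c [^]\<^bsub>G\<^esub> (4::nat) = \<one>\<^bsub>G\<^esub>)"
proof -
  let ?c = "homotopy_class X SO g"
  have n3: "CARD('n) \<ge> 3" using assms(1,2) by simp
  fix a :: 'n
  obtain b where "b \<noteq> a" by (rule obtain_third_index[OF n3, of a a])
  then have ab: "a \<noteq> b" by simp
  obtain d where d: "d \<noteq> a" "d \<noteq> b" by (rule obtain_third_index[OF n3])
  have g: "continuous_map X SO g" using assms(11) by (simp add: has_clutching_function_def)
  have \<eta>: "central_path \<eta>" using assms(7) by (simp add: central_path_def loops_def)
  have \<gamma>: "central_path \<gamma>" using assms(3-6) by (simp add: central_path_def)
  have \<gamma>2: "central_path (\<lambda>t. \<gamma> t ** \<gamma> t)" by (rule central_path_mult[OF \<gamma> \<gamma>])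
  have null: "(\<lambda>t. \<eta> t ** \<eta> t) \<simeq> (\<lambda>_. mat 1)" by (rule loop_square_null[OF n3 assms(7)])
  have turn: "\<eta> \<simeq> turns a b 1" by (rule generator_homotopic_turn[OF n3 ab assms(7,8)])
  have square: "(\<lambda>t. \<gamma> t ** \<gamma> t) \<simeq> turns a b (int k)"
    by (rule square_path_to_minus_one[OF assms(2,1) ab assms(3-6)])
  have "TO X \<eta> ?c [^]\<^bsub>SO_classes (suspension X)\<^esub> (2::nat) = \<one>\<^bsub>SO_classes (suspension X)\<^esub>"
    unfolding TO_power2[OF \<eta> g] TO_one[OF g, symmetric]
    by (rule TO_cong[OF central_path_mult[OF \<eta> \<eta>] null g])
  moreover have "TO X (\<eta> +++ \<gamma>) ?c = TO X \<eta> ?c \<otimes>\<^bsub>SO_classes (suspension X)\<^esub> TO X \<gamma> ?c"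
  proof -
    have "\<eta> +++ \<gamma> \<simeq> (\<lambda>t. \<eta> t ** \<gamma> t)"
      using assms(3-7) by (intro join_path_homotopic_mult) (auto simp: loops_def)
    from TO_cong[OF central_path_mult[OF \<eta> \<gamma>] homotopic_paths_sym[OF this] g] show ?thesis
      by (simp add: TO_mult[OF \<eta> \<gamma> g])
  qed
  moreover have "TO X \<gamma> ?c [^]\<^bsub>SO_classes (suspension X)\<^esub> (2::nat) = \<one>\<^bsub>SO_classes (suspension X)\<^esub>"
    if parity: "even k"
  proof -
    obtain m where "int k = 2 * m" using parity by (metis even_of_nat evenE)
    then have "turns a b (int k) \<simeq> (\<lambda>_. mat 1)"
      using turns_even[OF ab d, of m] by simp
    with square have "(\<lambda>t. \<gamma> t ** \<gamma> t) \<simeq> (\<lambda>_. mat 1)"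
      by (rule homotopic_paths_trans)
    from TO_cong[OF \<gamma>2 this g] show ?thesis
      by (simp add: TO_power2[OF \<gamma> g] TO_one[OF g])
  qed
  moreover have "TO X \<gamma> ?c [^]\<^bsub>SO_classes (suspension X)\<^esub> (2::nat) = TO X \<eta> ?c \<and>
      TO X \<gamma> ?c [^]\<^bsub>SO_classes (suspension X)\<^esub> (4::nat) = \<one>\<^bsub>SO_classes (suspension X)\<^esub>"
    if parity: "odd k"
  proof -
    obtain m where "int k = 2 * m + 1" using parity by (metis even_of_nat oddE)
    then have "turns a b (int k) \<simeq> turns a b 1"
      using turns_odd[OF ab d, of m] by simp
    with square have "(\<lambda>t. \<gamma> t ** \<gamma> t) \<simeq> turns a b 1"
      by (rule homotopic_paths_trans)
    then have \<gamma>\<eta>: "(\<lambda>t. \<gamma> t ** \<gamma> t) \<simeq> \<eta>"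
      using turn homotopic_paths_sym homotopic_paths_trans by blast
    then have "(\<lambda>t. (\<gamma> t ** \<gamma> t) ** (\<gamma> t ** \<gamma> t)) \<simeq> (\<lambda>_. mat 1)"
      using path_homotopic_mult[OF \<gamma>\<eta> \<gamma>\<eta>] null homotopic_paths_trans by blast
    from TO_cong[OF central_path_mult[OF \<gamma>2 \<gamma>2] this g] TO_cong[OF \<gamma>2 \<gamma>\<eta> g] show ?thesis
      by (simp add: TO_power2[OF \<gamma> g] TO_power4[OF \<gamma> g] TO_one[OF g])
  qed
  ultimately show ?thesis by (simp add: Let_def)
qed

end
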